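(* Let $X \subset \mathbb{R}^n$ be a closed semi-algebraic set and let $G \colon X \to \mathbb{R}^m$ be a continuous semi-algebraic mapping. Then the set $$\{F\in L(\mathbb{R}^n, \mathbb{R}^m) \ : \ (F + G)(X) \text{ is closed in } \mathbb{R}^m\}$$ is semi-algebraic and contains an open dense semi-algebraic subset of $L(\mathbb{R}^n, \mathbb{R}^m)$.
   Context: $L(\mathbb{R}^n,\mathbb{R}^m)$ denotes the space of all linear mappings $\mathbb{R}^n\to\mathbb{R}^m$, identified with $\mathbb{R}^{m\times n}$ via matrices in the canonical bases (so semi-algebraicity, openness and density refer to this identification). For $F \in L(\mathbb{R}^n,\mathbb{R}^m)$, $(F+G)(X) = \{F(x)+G(x) : x \in X\}$. A subset of $\mathbb{R}^N$ is semi-algebraic if it is a finite union of sets of the form $\{x : f(x)=0,\ g_1(x)>0,\dots,g_k(x)>0\}$ with $f,g_i$ polynomials; a mapping between semi-algebraic sets is semi-algebraic if its graph is semi-algebraic. *)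

theory Defs
  imports "HOL-Analysis.Analysis"
begin

inductive_set poly_fun :: "('a::euclidean_space \<Rightarrow> real) set" where
  const: "(\<lambda>x. c) \<in> poly_fun"
| coord: "b \<in> Basis \<Longrightarrow> (\<lambda>x. x \<bullet> b) \<in> poly_fun"
| add: "p \<in> poly_fun \<Longrightarrow> q \<in> poly_fun \<Longrightarrow> (\<lambda>x. p x + q x) \<in> poly_fun"
| mult: "p \<in> poly_fun \<Longrightarrow> q \<in> poly_fun \<Longrightarrow> (\<lambda>x. p x * q x) \<in> poly_fun"

definition basic_semialgebraic :: "'a::euclidean_space set \<Rightarrow> bool" where
  "basic_semialgebraic S \<longleftrightarrow>
     (\<exists>f gs. f \<in> poly_fun \<and> (\<forall>g\<in>set gs. g \<in> poly_fun) \<and>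
        S = {x. f x = 0 \<and> (\<forall>g\<in>set gs. g x > 0)})"

definition semialgebraic :: "'a::euclidean_space set \<Rightarrow> bool" where
  "semialgebraic S \<longleftrightarrow>
     (\<exists>\<A>. finite \<A> \<and> (\<forall>A\<in>\<A>. basic_semialgebraic A) \<and> S = \<Union>\<A>)"

definition semialgebraic_map ::
    "'a::euclidean_space set \<Rightarrow> ('a \<Rightarrow> 'b::euclidean_space) \<Rightarrow> bool" where
  "semialgebraic_map X G \<longleftrightarrow> semialgebraic {(x, G x) | x. x \<in> X}"

end

theory Submission
  imports Defs "HOL-Computational_Algebra.Polynomial"
begin

text \<open>
  Closedness of the image is a first-order condition on \<open>F\<close>, so the first claim is an instance of
  the Tarski--Seidenberg theorem. The latter rests on Hoermander's elimination: if the signs of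
  finitely many suitable polynomials agree at two parameters, then an increasing bijection of the
  line carries the signs of a given family of univariate polynomials at one parameter to those at
  the other.

  For the second claim, let \<open>Y\<close> be the graph of \<open>G\<close>, a closed semialgebraic set. The image
  \<open>(F + G)(X)\<close> is closed as soon as \<open>Y + V\<close> is closed, where \<open>V\<close> is the kernel of
  \<open>(x, y) \<mapsto> F x + y\<close>, and \<open>V\<close> can be added one line at a time. So let \<open>Y\<close> be closed and
  semialgebraic. Its frontier lies in the zero set of a nonzero polynomial \<open>f\<close>. If the leading
  form of \<open>f\<close> does not vanish at \<open>v\<close>, then projecting the frontier along \<open>v\<close> is a proper map;
  hence a line parallel to \<open>v\<close> that misses \<open>Y\<close> has a neighbourhood, consisting of parallel lines,
  that misses the frontier, and by connectedness this neighbourhood misses \<open>Y\<close>. Thus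
  \<open>Y + \<real>v\<close> is closed for all \<open>v\<close> outside a proper algebraic set, and the good \<open>F\<close> are dense.
  A dense semialgebraic set contains the complement of a proper algebraic set.
\<close>

section \<open>Sign patterns of piecewise monotone functions\<close>

lemma strict_mono_surj_change_above:
  fixes \<phi> :: "'a::linordered_field \<Rightarrow> 'a"
  assumes \<phi>: "strict_mono \<phi>" "surj \<phi>" and "m < b" "\<phi> m < y"
  obtains \<psi> where "strict_mono \<psi>" "surj \<psi>" "\<And>t. t \<le> m \<Longrightarrow> \<psi> t = \<phi> t" "\<psi> b = y"
proof
  define k where "k = (y - \<phi> m) / (b - m)"
  have "k > 0" using assms by (simp add: k_def)
  let ?\<psi> = "\<lambda>t. if t \<le> m then \<phi> t else \<phi> m + k * (t - m)"
  show "strict_mono ?\<psi>"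
  proof (rule strict_monoI)
    fix t u :: 'a assume "t < u"
    moreover have "\<phi> t \<le> \<phi> m" if "t \<le> m" using \<phi>(1) that by (simp add: strict_mono_less_eq)
    moreover have "k * (u - m) > 0" if "m < u" using \<open>k > 0\<close> that by simp
    moreover have "k * (t - m) < k * (u - m)" using \<open>k > 0\<close> \<open>t < u\<close> by simp
    ultimately show "?\<psi> t < ?\<psi> u"
      using strict_monoD[OF \<phi>(1) \<open>t < u\<close>] by auto
  qed
  have "z \<in> range ?\<psi>" for z
  proof (cases "z \<le> \<phi> m")
    case True
    obtain t where "z = \<phi> t" using \<phi>(2) by (rule surjE)
    moreover from this have "t \<le> m" using True strict_mono_less_eq[OF \<phi>(1)] by simp
    ultimately show ?thesis by (intro range_eqI[of _ _ t]) simp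
  next
    case False
    then have "(z - \<phi> m) / k > 0" using \<open>k > 0\<close> by simp
    then show ?thesis using \<open>k > 0\<close> by (intro range_eqI[of _ _ "m + (z - \<phi> m) / k"]) simp
  qed
  then show "surj ?\<psi>" by blast
  show "?\<psi> t = \<phi> t" if "t \<le> m" for t using that by simp
  show "?\<psi> b = y" using \<open>m < b\<close> by (simp add: k_def)
qed

lemma strict_mono_on_finite_extension:
  fixes \<theta> :: "'a::linordered_field \<Rightarrow> 'a"
  assumes "finite A" "strict_mono_on A \<theta>"
  shows "\<exists>\<psi>. strict_mono \<psi> \<and> surj \<psi> \<and> (\<forall>a\<in>A. \<psi> a = \<theta> a)"
  using assms
proof (induction rule: finite_linorder_max_induct)
  case empty
  show ?case by (intro exI[of _ id]) (simp add: strict_mono_on_id strict_monoI)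
next
  case (insert b A)
  have "strict_mono_on A \<theta>" using insert.prems by (rule monotone_on_subset) blast
  then obtain \<phi> where \<phi>: "strict_mono \<phi>" "surj \<phi>" "\<And>a. a \<in> A \<Longrightarrow> \<phi> a = \<theta> a"
    using insert.IH by blast
  obtain m where m: "m < b" "\<phi> m < \<theta> b" "\<And>a. a \<in> A \<Longrightarrow> a \<le> m"
  proof (cases "A = {}")
    case True
    obtain x where "\<phi> x = \<theta> b - 1" using \<phi>(2) by (metis surjD)
    moreover have "\<phi> (min x (b - 1)) \<le> \<phi> x" using \<phi>(1) by (simp add: strict_mono_less_eq)
    ultimately show ?thesis using that[of "min x (b - 1)"] True by simp
  next
    case False
    then have "Max A \<in> A" using insert.hyps(1) by simp
    then have "\<theta> (Max A) < \<theta> b"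
      using insert.hyps(2) by (auto intro: strict_mono_onD[OF insert.prems])
    then show ?thesis
      using that[of "Max A"] insert.hyps \<phi>(3) \<open>Max A \<in> A\<close> by simp
  qed
  obtain \<psi> where "strict_mono \<psi>" "surj \<psi>" "\<And>t. t \<le> m \<Longrightarrow> \<psi> t = \<phi> t" "\<psi> b = \<theta> b"
    using strict_mono_surj_change_above[OF \<phi>(1,2) m(1,2)] by blast
  then show ?case using \<phi>(3) m(3) by (intro exI[of _ \<psi>]) auto
qed

definition same_cell :: "'a::linorder set \<Rightarrow> 'a \<Rightarrow> 'a \<Rightarrow> bool" where
  "same_cell Z t u \<longleftrightarrow> (\<forall>a\<in>Z. (a < t \<longleftrightarrow> a < u) \<and> (t < a \<longleftrightarrow> u < a))"

lemma same_cell_sym: "same_cell Z t u \<Longrightarrow> same_cell Z u t"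
  by (auto simp: same_cell_def)

lemma same_cell_trans: "same_cell Z t u \<Longrightarrow> same_cell Z u v \<Longrightarrow> same_cell Z t v"
  by (auto simp: same_cell_def)

lemma same_cell_eq: "same_cell Z a t \<Longrightarrow> a \<in> Z \<Longrightarrow> t = a"
  by (metis same_cell_def less_irrefl linorder_less_linear)

lemma same_cellI:
  "t \<le> u \<Longrightarrow> (\<And>a. a \<in> Z \<Longrightarrow> t \<le> a \<Longrightarrow> a \<le> u \<Longrightarrow> False) \<Longrightarrow> same_cell Z t u"
  unfolding same_cell_def by (meson leD le_less_linear less_imp_le order.trans)

lemma same_cell_uminus:
  fixes t u :: "'a::linordered_ab_group_add"
  shows "same_cell (uminus ` Z) (- t) (- u) \<longleftrightarrow> same_cell Z t u"
  by (auto simp: same_cell_def)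

text \<open>Here \<open>s m\<close> is the direction, \<open>1\<close> or \<open>-1\<close>, in which \<open>F\<close> is monotone around \<open>m\<close>.\<close>

definition piecewise_monotone :: "real set \<Rightarrow> (real \<Rightarrow> real) \<Rightarrow> (real \<Rightarrow> real) \<Rightarrow> bool" where
  "piecewise_monotone Z s F \<longleftrightarrow> continuous_on UNIV F \<and>
    (\<forall>t m u. t < m \<longrightarrow> m < u \<longrightarrow> {t<..<u} \<inter> Z = {} \<longrightarrow> sgn (F u - F t) = s m \<and> F t \<noteq> F u) \<and>
    (\<forall>t C. (\<exists>r<t. C < \<bar>F r\<bar>) \<and> (\<exists>r>t. C < \<bar>F r\<bar>))"

definition sgn_compatible :: "real set \<Rightarrow> (real \<Rightarrow> real) \<Rightarrow> (real \<Rightarrow> real) \<Rightarrow> bool" where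
  "sgn_compatible Z F H \<longleftrightarrow> finite Z \<and> (\<forall>a\<in>Z. sgn (F a) = sgn (H a)) \<and>
    (\<exists>s. piecewise_monotone Z s F \<and> piecewise_monotone Z s H)"

lemma piecewise_monotoneD:
  assumes "piecewise_monotone Z s F"
  shows "continuous_on A F"
    and "t < m \<Longrightarrow> m < u \<Longrightarrow> {t<..<u} \<inter> Z = {} \<Longrightarrow> sgn (F u - F t) = s m"
    and "t < m \<Longrightarrow> m < u \<Longrightarrow> {t<..<u} \<inter> Z = {} \<Longrightarrow> F t \<noteq> F u"
    and "\<exists>r<t. C < \<bar>F r\<bar>" and "\<exists>r>t. C < \<bar>F r\<bar>"
  using assms unfolding piecewise_monotone_def by (blast intro: continuous_on_subset)+

lemma piecewise_monotone_reflect: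
  assumes F: "piecewise_monotone Z s F"
  shows "piecewise_monotone (uminus ` Z) (\<lambda>m. - s (- m)) (\<lambda>t. F (- t))"
  unfolding piecewise_monotone_def
proof (intro conjI allI impI)
  show "continuous_on UNIV (\<lambda>t. F (- t))"
    using continuous_on_compose2[OF piecewise_monotoneD(1)[OF F, of UNIV], of UNIV uminus]
    by (simp add: continuous_intros)
next
  fix t m u assume tmu: "t < m" "m < u" "{t<..<u} \<inter> uminus ` Z = {}"
  then have "{- u<..<- t} \<inter> Z = {}"
    by (auto simp: disjoint_iff image_iff) (metis minus_minus neg_less_iff_less)
  then have "sgn (F (- t) - F (- u)) = s (- m)" "F (- u) \<noteq> F (- t)"
    using piecewise_monotoneD(2,3)[OF F, of "- u" "- m" "- t"] tmu by auto
  then show "sgn (F (- u) - F (- t)) = - s (- m)" "F (- t) \<noteq> F (- u)"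
    by (metis minus_diff_eq sgn_minus) (metis \<open>F (- u) \<noteq> F (- t)\<close>)
next
  show "\<exists>r<t. C < \<bar>F (- r)\<bar>" "\<exists>r>t. C < \<bar>F (- r)\<bar>" for t C
    using piecewise_monotoneD(4,5)[OF F, of "- t" C]
    by (metis minus_less_iff less_minus_iff minus_minus)+
qed

lemma sgn_compatible_sym: "sgn_compatible Z F H \<Longrightarrow> sgn_compatible Z H F"
  by (auto simp: sgn_compatible_def)

lemma sgn_compatible_reflect:
  "sgn_compatible Z F H \<Longrightarrow> sgn_compatible (uminus ` Z) (\<lambda>t. F (- t)) (\<lambda>t. H (- t))"
  unfolding sgn_compatible_def using piecewise_monotone_reflect by fastforce

lemma sgn_eq_if_no_zero:
  fixes F :: "'a::linear_continuum_topology \<Rightarrow> real"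
  assumes "continuous_on {t..u} F" "t \<le> u" "\<And>r. t \<le> r \<Longrightarrow> r \<le> u \<Longrightarrow> F r \<noteq> 0"
  shows "sgn (F t) = sgn (F u)"
proof (rule ccontr)
  assume "sgn (F t) \<noteq> sgn (F u)"
  moreover have "F t \<noteq> 0" "F u \<noteq> 0" using assms by auto
  ultimately consider (up) "F t \<le> 0" "0 \<le> F u" | (down) "F u \<le> 0" "0 \<le> F t"
    by (auto simp: sgn_if split: if_splits)
  then show False
  proof cases
    case up
    then show False using IVT'[of F t 0 u] assms by auto
  next
    case down
    then show False using IVT2'[of F u 0 t] assms by auto
  qed
qed

lemma finite_set_left_neighbour:
  fixes t :: "'a::linorder"
  assumes "finite Z"
  obtains "\<And>a. a \<in> Z \<Longrightarrow> t \<le> a" | a where "a \<in> Z" "a < t" "Z \<inter> {a<..<t} = {}"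
proof (cases "Z \<inter> {..<t} = {}")
  case True
  then show ?thesis using that(1) by force
next
  case False
  then have "Max (Z \<inter> {..<t}) \<in> Z \<inter> {..<t}" using assms by (intro Max_in) auto
  moreover have "b \<le> Max (Z \<inter> {..<t})" if "b \<in> Z" "b < t" for b
    using assms that by simp
  ultimately show ?thesis using that(2)[of "Max (Z \<inter> {..<t})"] by force
qed

lemma sgn_right_of_cut:
  assumes F: "piecewise_monotone Z s F" and t: "t \<notin> Z"
    and a: "Z \<inter> {a<..<t} = {}" "a < m" "m < t"
    and no_zero: "\<And>r. r \<le> t \<Longrightarrow> same_cell Z r t \<Longrightarrow> F r \<noteq> 0"
  shows "sgn (F t) = (if F a = 0 then s m else sgn (F a))"
proof (cases "F a = 0")
  case True
  then show ?thesis using piecewise_monotoneD(2)[OF F, of a m t] a by (simp add: Int_commute)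
next
  case False
  have "F r \<noteq> 0" if "a \<le> r" "r \<le> t" for r
  proof (cases "r = a")
    case r_ne_a: False
    have "same_cell Z r t"
    proof (rule same_cellI[OF that(2)])
      fix b assume "b \<in> Z" "r \<le> b" "b \<le> t"
      moreover from this have "a < b" "b < t" using r_ne_a that(1) t by (auto simp: less_le)
      ultimately show False using a(1) by auto
    qed
    then show ?thesis using no_zero that(2) by blast
  qed (use False in simp)
  then have "sgn (F a) = sgn (F t)"
    using a by (intro sgn_eq_if_no_zero piecewise_monotoneD(1)[OF F]) auto
  then show ?thesis using False by simp
qed

lemma sgn_left_of_all_cuts:
  assumes F: "piecewise_monotone Z s F" and t: "t \<notin> Z" "\<And>a. a \<in> Z \<Longrightarrow> t \<le> a" and "m < t"
    and no_zero: "\<And>r. r \<le> t \<Longrightarrow> same_cell Z r t \<Longrightarrow> F r \<noteq> 0"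
  shows "sgn (F t) = - s m"
proof -
  obtain r where r: "r < m" "\<bar>F t\<bar> < \<bar>F r\<bar>" using piecewise_monotoneD(4)[OF F] by blast
  have "same_cell Z u t" if "u \<le> t" for u
    using that t by (metis same_cellI order_antisym)
  then have "sgn (F r) = sgn (F t)"
    using r(1) \<open>m < t\<close> no_zero by (intro sgn_eq_if_no_zero piecewise_monotoneD(1)[OF F]) auto
  moreover have "sgn (F t - F r) = s m"
    using piecewise_monotoneD(2)[OF F r(1) \<open>m < t\<close>] t(2) by force
  moreover have "sgn (F t - F r) = - sgn (F r)"
    using r(2) by (auto simp: sgn_if abs_if split: if_splits)
  ultimately show ?thesis by simp
qed

lemma sgn_compatible_sgn_eq_from_left:
  assumes FH: "sgn_compatible Z F H" and tu: "same_cell Z t u" and t: "t \<notin> Z"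
    and F: "\<And>r. r \<le> t \<Longrightarrow> same_cell Z r t \<Longrightarrow> F r \<noteq> 0"
    and H: "\<And>r. r \<le> u \<Longrightarrow> same_cell Z r u \<Longrightarrow> H r \<noteq> 0"
  shows "sgn (F t) = sgn (H u)"
proof -
  obtain s where s: "piecewise_monotone Z s F" "piecewise_monotone Z s H"
    and Z: "finite Z" "\<And>a. a \<in> Z \<Longrightarrow> sgn (F a) = sgn (H a)"
    using FH by (auto simp: sgn_compatible_def)
  have u: "u \<notin> Z" using tu t same_cell_eq same_cell_sym by blast
  consider (none) "\<And>a. a \<in> Z \<Longrightarrow> t \<le> a"
    | (neighbour) a where "a \<in> Z" "a < t" "Z \<inter> {a<..<t} = {}"
    using finite_set_left_neighbour[OF Z(1), of t] by metis
  then show ?thesis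
  proof cases
    case none
    then have "u \<le> a" if "a \<in> Z" for a using that tu by (force simp: same_cell_def)
    with none show ?thesis
      using sgn_left_of_all_cuts[OF s(1) t none _ F, of "min t u - 1"]
        sgn_left_of_all_cuts[OF s(2) u _ _ H, of "min t u - 1"] by simp
  next
    case (neighbour a)
    have "a < u" using tu neighbour by (auto simp: same_cell_def)
    have "b \<notin> {a<..<u}" if "b \<in> Z" for b
    proof -
      have "\<not> (a < b \<and> b < t)" using neighbour(3) that by auto
      moreover have "b \<noteq> t" using that t by blast
      ultimately show ?thesis using tu that by (auto simp: same_cell_def)
    qed
    then have a: "a < min t u" "Z \<inter> {a<..<u} = {}" using \<open>a < t\<close> \<open>a < u\<close> by auto
    then obtain m where "a < m" "m < min t u" using dense by blast
    then show ?thesis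
      using sgn_right_of_cut[OF s(1) t neighbour(3) _ _ F, of m]
        sgn_right_of_cut[OF s(2) u a(2) _ _ H, of m] Z(2)[OF neighbour(1)]
      by (auto simp: sgn_0_0)
  qed
qed

lemma sgn_compatible_sgn_eq_from_right:
  assumes FH: "sgn_compatible Z F H" and tu: "same_cell Z t u" and t: "t \<notin> Z"
    and F: "\<And>r. t \<le> r \<Longrightarrow> same_cell Z r t \<Longrightarrow> F r \<noteq> 0"
    and H: "\<And>r. u \<le> r \<Longrightarrow> same_cell Z r u \<Longrightarrow> H r \<noteq> 0"
  shows "sgn (F t) = sgn (H u)"
proof -
  have "sgn (F (- (- t))) = sgn (H (- (- u)))"
    by (rule sgn_compatible_sgn_eq_from_left[OF sgn_compatible_reflect[OF FH]])
       (use tu t F H same_cell_uminus[of Z "- _"] in \<open>auto simp: same_cell_uminus\<close>)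
  then show ?thesis by simp
qed

lemma piecewise_monotone_same_direction:
  assumes F: "piecewise_monotone Z s F" and "l < c" "c < r" "{l<..<r} \<inter> Z = {}"
  shows "sgn (F c - F l) = sgn (F r - F l)" "sgn (F r - F c) = sgn (F r - F l)"
proof -
  obtain m n where mn: "l < m" "m < c" "c < n" "n < r" using assms dense by meson
  have "{l<..<c} \<inter> Z = {}" "{c<..<r} \<inter> Z = {}"
    using assms(2-4) by (auto simp: disjoint_iff)
  then have "sgn (F c - F l) = s m" "sgn (F r - F c) = s n"
    using mn by (auto intro: piecewise_monotoneD(2)[OF F])
  moreover have "sgn (F r - F l) = s m" "sgn (F r - F l) = s n"
    using mn assms(4) by (auto intro!: piecewise_monotoneD(2)[OF F])
  ultimately show "sgn (F c - F l) = sgn (F r - F l)" "sgn (F r - F c) = sgn (F r - F l)"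
    by simp_all
qed

lemma piecewise_monotone_inj_on_cell:
  assumes F: "piecewise_monotone Z s F" and "same_cell Z t u" "F t = F u"
  shows "t = u"
proof -
  have "F a \<noteq> F b" if "a < b" "same_cell Z a b" for a b
  proof -
    have "{a<..<b} \<inter> Z = {}" using that by (auto simp: same_cell_def)
    then show ?thesis using piecewise_monotoneD(3)[OF F] dense[OF that(1)] by blast
  qed
  then show ?thesis using assms same_cell_sym by (metis linorder_less_linear)
qed

text \<open>
  Without a zero in the cell of \<open>c\<close>, the function \<open>H\<close> has the same sign on the whole cell, and so
  has \<open>F\<close> to the left and to the right of its only zero \<open>c\<close>, where it has to change sign.
\<close>

lemma sgn_compatible_zero_transfer:
  assumes FH: "sgn_compatible Z F H" and c: "F c = 0"
  shows "\<exists>d. same_cell Z c d \<and> H d = 0"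
proof (rule ccontr)
  assume "\<not> ?thesis"
  then have H: "H d \<noteq> 0" if "same_cell Z d c" for d using that same_cell_sym by blast
  obtain s where s: "piecewise_monotone Z s F"
    and Z: "finite Z" "\<And>a. a \<in> Z \<Longrightarrow> sgn (F a) = sgn (H a)"
    using FH by (auto simp: sgn_compatible_def)
  have "c \<notin> Z" using Z(2)[of c] H[of c] c by (auto simp: same_cell_def sgn_0_0)
  then obtain e where e: "e > 0" "\<And>a. a \<in> Z \<Longrightarrow> e \<le> dist c a"
    using finite_set_avoid[OF Z(1), of c] by metis
  define l r where "l = c - e / 2" and "r = c + e / 2"
  have lr: "l < c" "c < r" using e(1) by (auto simp: l_def r_def)
  have no_cut: "a \<notin> Z" if "l \<le> a" "a \<le> r" for a
    using e(1) e(2)[of a] that by (auto simp: l_def r_def dist_real_def)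
  then have cell: "same_cell Z c l" "same_cell Z c r"
    using lr by (meson same_cellI same_cell_sym less_imp_le order.trans)+
  have F: "t = c" if "F t = 0" "same_cell Z t c" for t
    using piecewise_monotone_inj_on_cell[OF s that(2)] that(1) c by simp
  have "sgn (F l) = sgn (H c)"
  proof (rule sgn_compatible_sgn_eq_from_left[OF FH same_cell_sym[OF cell(1)]])
    show "F t \<noteq> 0" if "t \<le> l" "same_cell Z t l" for t
      using F[of t] that lr(1) same_cell_trans[OF _ same_cell_sym[OF cell(1)]] by fastforce
  qed (use no_cut lr H in auto)
  moreover have "sgn (F r) = sgn (H c)"
  proof (rule sgn_compatible_sgn_eq_from_right[OF FH same_cell_sym[OF cell(2)]])
    show "F t \<noteq> 0" if "r \<le> t" "same_cell Z t r" for t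
      using F[of t] that lr(2) same_cell_trans[OF _ same_cell_sym[OF cell(2)]] by fastforce
  qed (use no_cut lr H in auto)
  moreover have "sgn (F r - F l) \<noteq> 0"
    using piecewise_monotone_inj_on_cell[OF s, of l r] same_cell_trans[of Z l c r]
      same_cell_sym[OF cell(1)] cell(2) lr by (auto simp: sgn_0_0)
  moreover have "H c \<noteq> 0" using H by (simp add: same_cell_def)
  moreover have "sgn (F c - F l) = sgn (F r - F l)" "sgn (F r - F c) = sgn (F r - F l)"
    using piecewise_monotone_same_direction[OF s lr] no_cut by fastforce+
  ultimately show False using c by (auto simp: sgn_if split: if_splits)
qed

lemma same_cell_if_fixed:
  assumes "strict_mono \<eta>" "\<And>a. a \<in> Z \<Longrightarrow> \<eta> a = a"
  shows "same_cell Z t (\<eta> t)"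
  unfolding same_cell_def by (metis assms strict_mono_less)

lemma sgn_compatible_zero_matching:
  assumes FH: "sgn_compatible Z F H" and fin: "finite {t. F t = 0}"
  obtains \<eta> where "strict_mono \<eta>" "surj \<eta>" "\<And>a. a \<in> Z \<Longrightarrow> \<eta> a = a"
    "\<And>c. F c = 0 \<Longrightarrow> H (\<eta> c) = 0"
proof -
  obtain s where F: "piecewise_monotone Z s F"
    and "finite Z" using FH by (auto simp: sgn_compatible_def)
  define A where "A = Z \<union> {t. F t = 0}"
  have "\<exists>d. same_cell Z c d \<and> (F c = 0 \<longrightarrow> H d = 0)" if "c \<in> A" for c
    using sgn_compatible_zero_transfer[OF FH, of c] by (cases "F c = 0") (auto simp: same_cell_def)
  then obtain \<theta> where \<theta>: "\<And>c. c \<in> A \<Longrightarrow> same_cell Z c (\<theta> c)"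
      "\<And>c. c \<in> A \<Longrightarrow> F c = 0 \<Longrightarrow> H (\<theta> c) = 0"
    by metis
  have "\<theta> c < \<theta> d" if cd: "c \<in> A" "d \<in> A" "c < d" for c d
  proof (cases "\<exists>a\<in>Z. c \<le> a \<and> a \<le> d")
    case True
    then show ?thesis
      using \<theta>(1)[OF cd(1)] \<theta>(1)[OF cd(2)] cd(3) by (force simp: same_cell_def)
  next
    case False
    then have "same_cell Z c d" "F c = 0" "F d = 0"
      using cd by (force simp: same_cell_def A_def)+
    then show ?thesis using piecewise_monotone_inj_on_cell[OF F] cd(3) by fastforce
  qed
  then have mono: "strict_mono_on A \<theta>" by (rule strict_mono_onI)
  have "finite A" using \<open>finite Z\<close> fin by (simp add: A_def)
  obtain \<eta> where \<eta>: "strict_mono \<eta>" "surj \<eta>" "\<And>a. a \<in> A \<Longrightarrow> \<eta> a = \<theta> a"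
    using strict_mono_on_finite_extension[OF \<open>finite A\<close> mono] by blast
  show ?thesis
  proof (rule that[OF \<eta>(1,2)])
    show "\<eta> a = a" if "a \<in> Z" for a
      using that \<eta>(3)[of a] \<theta>(1)[of a] same_cell_eq[of Z a "\<theta> a"] by (simp add: A_def)
    show "H (\<eta> c) = 0" if "F c = 0" for c
      using that \<eta>(3)[of c] \<theta>(2)[of c] by (simp add: A_def)
  qed
qed

lemma sgn_compatible_zero_preimage:
  assumes FH: "sgn_compatible Z F H"
    and \<eta>: "\<And>t. same_cell Z t (\<eta> t)" "\<And>c. F c = 0 \<Longrightarrow> H (\<eta> c) = 0" and "H d = 0"
  obtains c where "F c = 0" "\<eta> c = d"
proof -
  obtain s where H: "piecewise_monotone Z s H" using FH by (auto simp: sgn_compatible_def)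
  obtain c where c: "same_cell Z d c" "F c = 0"
    using sgn_compatible_zero_transfer[OF sgn_compatible_sym[OF FH] \<open>H d = 0\<close>] by blast
  then have "\<eta> c = d"
    using piecewise_monotone_inj_on_cell[OF H same_cell_trans[OF c(1) \<eta>(1)]] \<eta>(2) \<open>H d = 0\<close>
    by simp
  then show ?thesis using c(2) that by blast
qed

lemma sgn_compatible_sgn_eq:
  assumes FH: "sgn_compatible Z F H"
    and \<eta>: "strict_mono \<eta>" "\<And>a. a \<in> Z \<Longrightarrow> \<eta> a = a" "\<And>c. F c = 0 \<Longrightarrow> H (\<eta> c) = 0"
  shows "sgn (F t) = sgn (H (\<eta> t))"
proof (cases "t \<in> Z \<or> F t = 0")
  case True
  then show ?thesis using \<eta>(2)[of t] \<eta>(3)[of t] FH by (auto simp: sgn_compatible_def)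
next
  case False
  obtain s where F: "piecewise_monotone Z s F" using FH by (auto simp: sgn_compatible_def)
  have cell: "same_cell Z r (\<eta> r)" for r using same_cell_if_fixed[OF \<eta>(1,2)] .
  have zero_H: "\<exists>c. F c = 0 \<and> \<eta> c = d \<and> same_cell Z c t" if "H d = 0" "same_cell Z d (\<eta> t)" for d
    using sgn_compatible_zero_preimage[OF FH cell \<eta>(3) that(1)] that(2) cell
      same_cell_sym same_cell_trans by metis
  have "c = d" if "F c = 0" "F d = 0" "same_cell Z c t" "same_cell Z d t" for c d
    using piecewise_monotone_inj_on_cell[OF F] that same_cell_sym same_cell_trans by metis
  then consider (left) "\<forall>c\<le>t. same_cell Z c t \<longrightarrow> F c \<noteq> 0"
    | (right) "\<forall>c\<ge>t. same_cell Z c t \<longrightarrow> F c \<noteq> 0"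
    using False by (metis order_antisym)
  then show ?thesis
  proof cases
    case left
    show ?thesis
      by (rule sgn_compatible_sgn_eq_from_left[OF FH cell])
         (use left False zero_H strict_mono_less_eq[OF \<eta>(1)] in blast)+
  next
    case right
    show ?thesis
      by (rule sgn_compatible_sgn_eq_from_right[OF FH cell])
         (use right False zero_H strict_mono_less_eq[OF \<eta>(1)] in blast)+
  qed
qed

section \<open>Matching the signs of univariate polynomials\<close>

definition matches_signs :: "(real \<Rightarrow> real) \<Rightarrow> (real poly \<times> real poly) set \<Rightarrow> bool" where
  "matches_signs \<phi> K \<longleftrightarrow> strict_mono \<phi> \<and> surj \<phi> \<and>
    (\<forall>(p, q)\<in>K. \<forall>t. sgn (poly p t) = sgn (poly q (\<phi> t)))"

lemma matches_signsD:
  assumes "matches_signs \<phi> K"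
  shows "strict_mono \<phi>" "surj \<phi>" "(p, q) \<in> K \<Longrightarrow> sgn (poly p t) = sgn (poly q (\<phi> t))"
  using assms by (auto simp: matches_signs_def)

lemma matches_signs_subset: "matches_signs \<phi> K \<Longrightarrow> L \<subseteq> K \<Longrightarrow> matches_signs \<phi> L"
  unfolding matches_signs_def by blast

lemma poly_unbounded_at_both_ends:
  fixes p :: "real poly"
  assumes "degree p > 0"
  shows "\<exists>r<t. C < \<bar>poly p r\<bar>" "\<exists>r>t. C < \<bar>poly p r\<bar>"
proof -
  have "filterlim (poly p) at_infinity at_infinity" using assms by (rule filterlim_poly_at_infinity)
  then have "\<forall>\<^sub>F r in at_infinity. C < \<bar>poly p r\<bar>"
    using filterlim_at_infinity_conv_norm_at_top filterlim_at_top_dense by fastforce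
  then have "\<forall>\<^sub>F r in at_bot. C < \<bar>poly p r\<bar>" "\<forall>\<^sub>F r in at_top. C < \<bar>poly p r\<bar>"
    using at_bot_le_at_infinity at_top_le_at_infinity filter_leD by blast+
  then have "\<forall>\<^sub>F r in at_bot. r < t \<and> C < \<bar>poly p r\<bar>" "\<forall>\<^sub>F r in at_top. r > t \<and> C < \<bar>poly p r\<bar>"
    by (auto intro: eventually_conj eventually_gt_at_bot eventually_gt_at_top)
  then show "\<exists>r<t. C < \<bar>poly p r\<bar>" "\<exists>r>t. C < \<bar>poly p r\<bar>"
    using eventually_happens trivial_limit_at_bot_linorder trivial_limit_at_top_linorder by blast+
qed

lemma continuous_on_strict_mono_surj:
  fixes \<phi> :: "'a::linorder_topology \<Rightarrow> 'b::{dense_order, linorder_topology}"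
  assumes "strict_mono \<phi>" "surj \<phi>"
  shows "continuous_on UNIV \<phi>"
  using assms by (intro continuous_onI_mono) (auto simp: strict_mono_less_eq)

lemma sgn_poly_eq_on_cell:
  fixes p :: "real poly"
  assumes "same_cell {r. poly p r = 0} t u"
  shows "sgn (poly p t) = sgn (poly p u)"
proof (cases "poly p t = 0")
  case True
  then show ?thesis using same_cell_eq[OF assms] by simp
next
  case False
  then have "poly p r \<noteq> 0" if "min t u \<le> r" "r \<le> max t u" for r
    using assms that by (force simp: same_cell_def min_def max_def split: if_splits)
  then have "sgn (poly p (min t u)) = sgn (poly p (max t u))"
    by (intro sgn_eq_if_no_zero) (auto intro: continuous_intros)
  then show ?thesis by (auto simp: min_def max_def split: if_splits)
qed

lemma piecewise_monotone_poly_compose: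
  fixes f h :: "real poly"
  assumes \<phi>: "matches_signs \<phi> {(pderiv f, pderiv h)}" and "degree h > 0"
    and Z: "{t. poly (pderiv f) t = 0} \<subseteq> Z"
  shows "piecewise_monotone Z (\<lambda>m. sgn (poly (pderiv f) m)) (\<lambda>t. poly h (\<phi> t))"
  unfolding piecewise_monotone_def
proof (intro conjI allI impI)
  note mono = strict_mono_less[OF matches_signsD(1)[OF \<phi>]]
  show "continuous_on UNIV (\<lambda>t. poly h (\<phi> t))"
    using continuous_on_strict_mono_surj[OF matches_signsD(1,2)[OF \<phi>]] by (intro continuous_intros)
  show "\<exists>r<t. C < \<bar>poly h (\<phi> r)\<bar>" "\<exists>r>t. C < \<bar>poly h (\<phi> r)\<bar>" for t C
    using poly_unbounded_at_both_ends[OF \<open>degree h > 0\<close>, of "\<phi> t" C] mono matches_signsD(2)[OF \<phi>]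
    by (metis surjD)+
  fix t m u assume tmu: "t < m" "m < u" "{t<..<u} \<inter> Z = {}"
  obtain y where y: "\<phi> t < y" "y < \<phi> u"
      "poly h (\<phi> u) - poly h (\<phi> t) = (\<phi> u - \<phi> t) * poly (pderiv h) y"
    using poly_MVT[of "\<phi> t" "\<phi> u" h] mono tmu by fastforce
  obtain x where "y = \<phi> x" using matches_signsD(2)[OF \<phi>] by (rule surjE)
  then have x: "t < x" "x < u" using y mono by auto
  have no_zero: "poly (pderiv f) r \<noteq> 0" if "t < r" "r < u" for r
    using that Z tmu(3) by (auto simp: disjoint_iff)
  have "a \<le> t \<or> u \<le> a" if "poly (pderiv f) a = 0" for a using no_zero[of a] that by linarith
  then have "same_cell {r. poly (pderiv f) r = 0} x m"
    using x tmu(1,2) by (fastforce simp: same_cell_def)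
  then have "sgn (poly (pderiv f) x) = sgn (poly (pderiv f) m)" by (rule sgn_poly_eq_on_cell)
  moreover have "sgn (poly h (\<phi> u) - poly h (\<phi> t)) = sgn (poly (pderiv f) x)"
    using y \<open>y = \<phi> x\<close> matches_signsD(3)[OF \<phi>] by (simp add: sgn_mult)
  ultimately show sgn: "sgn (poly h (\<phi> u) - poly h (\<phi> t)) = sgn (poly (pderiv f) m)" by simp
  show "poly h (\<phi> t) \<noteq> poly h (\<phi> u)"
    using sgn no_zero[OF tmu(1,2)] by (auto simp: sgn_0_0)
qed

lemma sgn_compatible_poly:
  fixes f h :: "real poly"
  assumes \<phi>: "matches_signs \<phi> {(pderiv f, pderiv h)}" and "pderiv f \<noteq> 0"
    and Z: "finite Z" "{t. poly (pderiv f) t = 0} \<subseteq> Z"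
    and "\<And>a. a \<in> Z \<Longrightarrow> sgn (poly f a) = sgn (poly h (\<phi> a))"
  shows "sgn_compatible Z (poly f) (\<lambda>t. poly h (\<phi> t))"
proof -
  have "pderiv h \<noteq> 0"
    using matches_signsD(3)[OF \<phi>] \<open>pderiv f \<noteq> 0\<close> by (metis insertI1 poly_all_0_iff_0 sgn_0 sgn_0_0)
  then have deg: "degree f > 0" "degree h > 0"
    using \<open>pderiv f \<noteq> 0\<close> by (auto simp: pderiv_eq_0_iff)
  have "matches_signs id {(pderiv f, pderiv f)}" by (simp add: matches_signs_def strict_mono_def)
  then have "piecewise_monotone Z (\<lambda>m. sgn (poly (pderiv f) m)) (\<lambda>t. poly f (id t))"
    using deg(1) Z(2) by (rule piecewise_monotone_poly_compose)
  moreover have "piecewise_monotone Z (\<lambda>m. sgn (poly (pderiv f) m)) (\<lambda>t. poly h (\<phi> t))"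
    using \<phi> deg(2) Z(2) by (rule piecewise_monotone_poly_compose)
  ultimately show ?thesis using assms(5) Z(1) by (auto simp: sgn_compatible_def)
qed

lemma matches_signs_insert:
  assumes \<phi>: "matches_signs \<phi> K" and "finite K"
    and deriv: "(pderiv f, pderiv h) \<in> K" "pderiv f \<noteq> 0"
    and roots: "\<And>p q t. (p, q) \<in> K \<Longrightarrow> p \<noteq> 0 \<Longrightarrow> poly p t = 0 \<Longrightarrow>
      sgn (poly f t) = sgn (poly h (\<phi> t))"
  shows "\<exists>\<psi>. matches_signs \<psi> (insert (f, h) K)"
proof -
  define Z where "Z = (\<Union>p\<in>fst ` K - {0}. {t. poly p t = 0})"
  have comp: "sgn_compatible Z (poly f) (\<lambda>t. poly h (\<phi> t))"
  proof (rule sgn_compatible_poly)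
    show "matches_signs \<phi> {(pderiv f, pderiv h)}"
      using \<phi> by (rule matches_signs_subset) (use deriv(1) in blast)
    show "finite Z" unfolding Z_def using \<open>finite K\<close> by (auto intro: poly_roots_finite)
    show "{t. poly (pderiv f) t = 0} \<subseteq> Z" unfolding Z_def using deriv by force
    show "sgn (poly f a) = sgn (poly h (\<phi> a))" if "a \<in> Z" for a
      using that roots unfolding Z_def by fastforce
  qed (rule deriv(2))
  have "f \<noteq> 0" using deriv(2) by auto
  then have "finite {t. poly f t = 0}" by (rule poly_roots_finite)
  then obtain \<eta> where \<eta>: "strict_mono \<eta>" "surj \<eta>" "\<And>a. a \<in> Z \<Longrightarrow> \<eta> a = a"
      "\<And>c. poly f c = 0 \<Longrightarrow> poly h (\<phi> (\<eta> c)) = 0"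
    using sgn_compatible_zero_matching[OF comp] by metis
  have "sgn (poly p t) = sgn (poly q (\<phi> (\<eta> t)))" if "(p, q) \<in> K" for p q t
  proof -
    have "same_cell {r. poly p r = 0} t (\<eta> t)" if "p \<noteq> 0"
      using that \<open>(p, q) \<in> K\<close> \<eta>(3) by (intro same_cell_if_fixed[OF \<eta>(1)]) (force simp: Z_def)
    then have "sgn (poly p t) = sgn (poly p (\<eta> t))" using sgn_poly_eq_on_cell by fastforce
    then show ?thesis using matches_signsD(3)[OF \<phi> that] by simp
  qed
  moreover have "sgn (poly f t) = sgn (poly h (\<phi> (\<eta> t)))" for t
    using sgn_compatible_sgn_eq[OF comp \<eta>(1,3,4)] .
  ultimately have "matches_signs (\<phi> \<circ> \<eta>) (insert (f, h) K)"
    unfolding matches_signs_def using \<eta>(1,2) matches_signsD(1,2)[OF \<phi>]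
    by (intro conjI strict_mono_o comp_surj) auto
  then show ?thesis by blast
qed

section \<open>Families of polynomials with parameters\<close>

lemma poly_fun_uminus: "p \<in> poly_fun \<Longrightarrow> (\<lambda>x. - p x) \<in> poly_fun"
  using poly_fun.mult[OF poly_fun.const[of "-1"]] by fastforce

lemma poly_fun_diff: "p \<in> poly_fun \<Longrightarrow> q \<in> poly_fun \<Longrightarrow> (\<lambda>x. p x - q x) \<in> poly_fun"
  using poly_fun.add[OF _ poly_fun_uminus, of p q] by simp

lemma poly_fun_power: "p \<in> poly_fun \<Longrightarrow> (\<lambda>x. p x ^ n) \<in> poly_fun"
  by (induction n) (auto intro: poly_fun.const poly_fun.mult)

lemma poly_fun_sum: "(\<And>i. i \<in> I \<Longrightarrow> p i \<in> poly_fun) \<Longrightarrow> (\<lambda>x. \<Sum>i\<in>I. p i x) \<in> poly_fun"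
  by (induction I rule: infinite_finite_induct) (auto intro: poly_fun.const poly_fun.add)

lemma poly_fun_prod:
  "(\<And>i. i \<in> I \<Longrightarrow> p i \<in> poly_fun) \<Longrightarrow> (\<lambda>x. \<Prod>i\<in>I. p i x) \<in> poly_fun"
  by (induction I rule: infinite_finite_induct) (auto intro: poly_fun.const poly_fun.mult)

lemmas poly_fun_intros = poly_fun.intros poly_fun_uminus poly_fun_diff poly_fun_power poly_fun_sum
  poly_fun_prod

definition param_poly :: "nat \<Rightarrow> ('a::euclidean_space \<Rightarrow> real poly) set" where
  "param_poly n = {P. (\<forall>i. (\<lambda>x. coeff (P x) i) \<in> poly_fun) \<and> (\<forall>x. \<forall>i\<ge>n. coeff (P x) i = 0)}"

lemma param_polyI:
  "(\<And>i. (\<lambda>x. coeff (P x) i) \<in> poly_fun) \<Longrightarrow> (\<And>x i. n \<le> i \<Longrightarrow> coeff (P x) i = 0) \<Longrightarrow> P \<in> param_poly n"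
  by (simp add: param_poly_def)

lemma param_polyD:
  assumes "P \<in> param_poly n"
  shows "(\<lambda>x. coeff (P x) i) \<in> poly_fun" "n \<le> i \<Longrightarrow> coeff (P x) i = 0"
  using assms by (auto simp: param_poly_def)

lemma param_poly_mono: "m \<le> n \<Longrightarrow> param_poly m \<subseteq> param_poly n"
  by (auto simp: param_poly_def)

lemma degree_param_poly_less:
  assumes "P \<in> param_poly n" "P x \<noteq> 0"
  shows "degree (P x) < n"
  using assms by (metis leading_coeff_0_iff not_le param_polyD(2))

lemma pderiv_param_poly: "P \<in> param_poly (Suc n) \<Longrightarrow> (\<lambda>x. pderiv (P x)) \<in> param_poly n"
  by (auto simp: param_poly_def coeff_pderiv intro!: poly_fun_intros)

lemma param_poly_add:
  assumes "P \<in> param_poly m" "R \<in> param_poly n"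
  shows "(\<lambda>x. P x + R x) \<in> param_poly (max m n)"
  using assms by (auto simp: param_poly_def intro: poly_fun_intros)

lemma param_poly_mult:
  assumes P: "P \<in> param_poly m" and R: "R \<in> param_poly n"
  shows "(\<lambda>x. P x * R x) \<in> param_poly (m + n)"
proof (rule param_polyI)
  show "(\<lambda>x. coeff (P x * R x) i) \<in> poly_fun" for i
    unfolding coeff_mult by (intro poly_fun_intros param_polyD(1)[OF P] param_polyD(1)[OF R])
  show "coeff (P x * R x) i = 0" if "m + n \<le> i" for x i
    unfolding coeff_mult
  proof (intro sum.neutral ballI)
    fix j assume "j \<in> {..i}"
    have "m \<le> j \<or> n \<le> i - j" using that by auto
    then show "coeff (P x) j * coeff (R x) (i - j) = 0"
      using param_polyD(2)[OF P] param_polyD(2)[OF R] by auto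
  qed
qed

text \<open>
  One step of pseudo-division by the part of \<open>g x\<close> of degree at most \<open>k\<close>. The factor of \<open>f x\<close> is
  a square, so that signs at the roots of \<open>g x\<close> are preserved.
\<close>

definition cancel_lead ::
    "nat \<Rightarrow> nat \<Rightarrow> ('a \<Rightarrow> real poly) \<Rightarrow> ('a \<Rightarrow> real poly) \<Rightarrow> 'a \<Rightarrow> real poly" where
  "cancel_lead n k f g x = smult ((coeff (g x) k)\<^sup>2) (f x) -
    smult (coeff (f x) n * coeff (g x) k) (monom 1 (n - k) * poly_cutoff (Suc k) (g x))"

lemma coeff_cancel_lead:
  "coeff (cancel_lead n k f g x) i = (coeff (g x) k)\<^sup>2 * coeff (f x) i - coeff (f x) n * coeff (g x) k *
    (if i < n - k \<or> k < i - (n - k) then 0 else coeff (g x) (i - (n - k)))"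
  by (simp add: cancel_lead_def coeff_monom_mult coeff_poly_cutoff)

lemma cancel_lead_param_poly:
  assumes f: "f \<in> param_poly (Suc n)" and g: "g \<in> param_poly m" and "k \<le> n"
  shows "cancel_lead n k f g \<in> param_poly n"
proof (rule param_polyI)
  note coeffs = param_polyD(1)[OF f] param_polyD(1)[OF g]
  show "(\<lambda>x. coeff (cancel_lead n k f g x) i) \<in> poly_fun" for i
    by (cases "i < n - k \<or> k < i - (n - k)")
       (auto simp: coeff_cancel_lead intro!: poly_fun_intros coeffs)
  show "coeff (cancel_lead n k f g x) i = 0" if "n \<le> i" for x i
  proof (cases "i = n")
    case True
    then show ?thesis using \<open>k \<le> n\<close> by (simp add: coeff_cancel_lead power2_eq_square)
  next
    case False
    then have "Suc n \<le> i" "k < i - (n - k)" using that \<open>k \<le> n\<close> by auto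
    then show ?thesis using param_polyD(2)[OF f] by (simp add: coeff_cancel_lead)
  qed
qed

lemma poly_cancel_lead_at_root:
  assumes "degree (g x) = k" "poly (g x) t = 0"
  shows "poly (cancel_lead n k f g x) t = (coeff (g x) k)\<^sup>2 * poly (f x) t"
proof -
  have "poly_cutoff (Suc k) (g x) = g x"
    using assms(1) by (auto simp: poly_eq_iff coeff_poly_cutoff coeff_eq_0)
  then show ?thesis using assms(2) by (simp add: cancel_lead_def)
qed

definition sgn_remainder ::
    "nat \<Rightarrow> ('a \<Rightarrow> real poly) \<Rightarrow> ('a \<Rightarrow> real poly) \<Rightarrow> ('a \<Rightarrow> real poly) \<Rightarrow> bool" where
  "sgn_remainder k f g r \<longleftrightarrow> (\<forall>x t. g x \<noteq> 0 \<longrightarrow> degree (g x) = k \<longrightarrow> poly (g x) t = 0 \<longrightarrow>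
    sgn (poly (f x) t) = sgn (poly (r x) t))"

lemma sgn_remainder_exists:
  assumes g: "g \<in> param_poly m" and f: "f \<in> param_poly n"
  shows "\<exists>r\<in>param_poly k. sgn_remainder k f g r"
  using f
proof (induction n arbitrary: f)
  case 0
  then show ?case using param_poly_mono[of 0 k] by (auto simp: sgn_remainder_def)
next
  case (Suc n)
  show ?case
  proof (cases "Suc n \<le> k")
    case True
    then show ?thesis using Suc.prems param_poly_mono by (auto simp: sgn_remainder_def)
  next
    case False
    then have "cancel_lead n k f g \<in> param_poly n"
      by (intro cancel_lead_param_poly[OF Suc.prems g]) simp
    then obtain r where r: "r \<in> param_poly k" "sgn_remainder k (cancel_lead n k f g) g r"
      using Suc.IH by blast
    have "sgn (poly (cancel_lead n k f g x) t) = sgn (poly (f x) t)"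
      if "g x \<noteq> 0" "degree (g x) = k" "poly (g x) t = 0" for x t
    proof -
      have "(coeff (g x) k)\<^sup>2 > 0" using that(1,2) by auto
      then show ?thesis
        using poly_cancel_lead_at_root[of g, OF that(2,3)] by (simp only: sgn_mult sgn_pos mult_1_left)
    qed
    then have "sgn_remainder k f g r" using r(2) by (simp add: sgn_remainder_def)
    then show ?thesis using r(1) by blast
  qed
qed

definition same_sgns :: "('a \<Rightarrow> real) set \<Rightarrow> 'a \<Rightarrow> 'a \<Rightarrow> bool" where
  "same_sgns Q x y \<longleftrightarrow> (\<forall>q\<in>Q. sgn (q x) = sgn (q y))"

lemma same_sgnsD: "same_sgns Q x y \<Longrightarrow> q \<in> Q \<Longrightarrow> sgn (q x) = sgn (q y)"
  by (simp add: same_sgns_def)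

lemma same_sgns_mono: "same_sgns Q x y \<Longrightarrow> R \<subseteq> Q \<Longrightarrow> same_sgns R x y"
  by (auto simp: same_sgns_def)

definition sgn_uniform :: "('a::euclidean_space \<Rightarrow> real poly) set \<Rightarrow> bool" where
  "sgn_uniform \<P> \<longleftrightarrow> (\<exists>Q. finite Q \<and> Q \<subseteq> poly_fun \<and>
    (\<forall>x y. same_sgns Q x y \<longrightarrow> (\<exists>\<phi>. matches_signs \<phi> ((\<lambda>P. (P x, P y)) ` \<P>))))"

lemma sgn_uniform_subset: "sgn_uniform \<Q> \<Longrightarrow> \<P> \<subseteq> \<Q> \<Longrightarrow> sgn_uniform \<P>"
  unfolding sgn_uniform_def by (meson image_mono matches_signs_subset)

lemma same_sgn_coeffs:
  fixes p q :: "real poly"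
  assumes "\<And>i. sgn (coeff p i) = sgn (coeff q i)"
  shows "degree p = degree q" "p = 0 \<longleftrightarrow> q = 0"
proof -
  have "coeff p i = 0 \<longleftrightarrow> coeff q i = 0" for i using assms[of i] by (metis sgn_0_0)
  then show "degree p = degree q" "p = 0 \<longleftrightarrow> q = 0" by (auto simp: degree_def poly_eq_iff)
qed

lemma matches_signs_insert_param_poly:
  assumes \<phi>: "matches_signs \<phi> ((\<lambda>g. (g x, g y)) ` (\<G> \<union> \<R>))" and "finite \<G>"
    and coeffs: "\<And>g i. g \<in> insert f \<G> \<Longrightarrow> sgn (coeff (g x) i) = sgn (coeff (g y) i)"
    and deriv: "(\<lambda>x. pderiv (f x)) \<in> \<G>"
    and rem: "\<And>g. g \<in> \<G> \<Longrightarrow> g x \<noteq> 0 \<Longrightarrow> \<exists>r\<in>\<R>. sgn_remainder (degree (g x)) f g r"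
  shows "\<exists>\<psi>. matches_signs \<psi> ((\<lambda>g. (g x, g y)) ` insert f \<G>)"
proof (cases "pderiv (f x) = 0")
  case True
  then have "degree (f x) = 0" "degree (f y) = 0"
    using same_sgn_coeffs(1)[of "f x" "f y"] coeffs by (auto simp: pderiv_eq_0_iff)
  then have "poly (f x) t = coeff (f x) 0" "poly (f y) t = coeff (f y) 0" for t
    by (auto simp: poly_altdef)
  then show ?thesis
    using \<phi> coeffs[of f 0] by (intro exI[of _ \<phi>]) (auto simp: matches_signs_def)
next
  case False
  have sgn: "sgn (poly (g x) t) = sgn (poly (g y) (\<phi> t))" if "g \<in> \<G> \<union> \<R>" for g t
    using matches_signsD(3)[OF \<phi>] that by blast
  let ?K = "(\<lambda>g. (g x, g y)) ` \<G>"
  have "\<exists>\<psi>. matches_signs \<psi> (insert (f x, f y) ?K)"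
  proof (rule matches_signs_insert)
    show "matches_signs \<phi> ?K" using \<phi> by (rule matches_signs_subset) blast
    show "finite ?K" using \<open>finite \<G>\<close> by simp
    show "(pderiv (f x), pderiv (f y)) \<in> ?K" using deriv by (auto simp: image_iff)
    fix p q t assume "(p, q) \<in> ?K" "p \<noteq> 0" and root: "poly p t = 0"
    then obtain g where g: "g \<in> \<G>" "g x \<noteq> 0" "p = g x" by blast
    then obtain r where r: "r \<in> \<R>" "sgn_remainder (degree (g x)) f g r" using rem by blast
    have "poly (g y) (\<phi> t) = 0" using sgn[of g t] g root by (metis UnCI sgn_0 sgn_0_0)
    moreover have "degree (g y) = degree (g x)" "g y \<noteq> 0"
      using same_sgn_coeffs[of "g x" "g y"] coeffs g by auto
    ultimately show "sgn (poly (f x) t) = sgn (poly (f y) (\<phi> t))"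
      using root g r sgn[of r t] by (simp add: sgn_remainder_def)
  qed (rule False)
  then show ?thesis by simp
qed

lemma sgn_uniform_insert:
  assumes fin: "finite \<G>" and bound: "insert f \<G> \<subseteq> param_poly N"
    and deriv: "(\<lambda>x. pderiv (f x)) \<in> \<G>"
    and rem: "\<And>g k. g \<in> \<G> \<Longrightarrow> k < N \<Longrightarrow> \<exists>r\<in>\<R>. sgn_remainder k f g r"
    and unif: "sgn_uniform (\<G> \<union> \<R>)"
  shows "sgn_uniform (insert f \<G>)"
proof -
  obtain Q where Q: "finite Q" "Q \<subseteq> poly_fun"
      "\<And>x y. same_sgns Q x y \<Longrightarrow> \<exists>\<phi>. matches_signs \<phi> ((\<lambda>g. (g x, g y)) ` (\<G> \<union> \<R>))"
    using unif unfolding sgn_uniform_def by blast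
  define C where "C = (\<lambda>(g, i) x. coeff (g x) i) ` (insert f \<G> \<times> {..<N})"
  have "finite (Q \<union> C)" using Q(1) fin by (simp add: C_def)
  moreover have "Q \<union> C \<subseteq> poly_fun" using Q(2) bound by (auto simp: C_def param_poly_def)
  moreover have "\<exists>\<psi>. matches_signs \<psi> ((\<lambda>g. (g x, g y)) ` insert f \<G>)"
    if xy: "same_sgns (Q \<union> C) x y" for x y
  proof -
    obtain \<phi> where "matches_signs \<phi> ((\<lambda>g. (g x, g y)) ` (\<G> \<union> \<R>))"
      using Q(3) same_sgns_mono[OF xy] by blast
    moreover have "sgn (coeff (g x) i) = sgn (coeff (g y) i)" if "g \<in> insert f \<G>" for g i
    proof (cases "i < N")
      case True
      then have "(\<lambda>x. coeff (g x) i) \<in> C" using that unfolding C_def by force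
      then show ?thesis using same_sgnsD[OF xy] by blast
    next
      case False
      then show ?thesis using param_polyD(2)[of g N i] bound that by auto
    qed
    moreover have "degree (g x) < N" if "g \<in> \<G>" "g x \<noteq> 0" for g
      using degree_param_poly_less bound that by blast
    ultimately show ?thesis
      using rem by (intro matches_signs_insert_param_poly[OF _ fin _ deriv]) blast+
  qed
  ultimately show ?thesis unfolding sgn_uniform_def by blast
qed

text \<open>
  Every polynomial of top degree is traded for its derivative and its remainders modulo the other
  members, all of which have a smaller degree bound.
\<close>

lemma sgn_uniform_Un:
  fixes \<F> \<P> :: "('a::euclidean_space \<Rightarrow> real poly) set"
  assumes low: "\<And>\<P> :: ('a \<Rightarrow> real poly) set. finite \<P> \<Longrightarrow> \<P> \<subseteq> param_poly N \<Longrightarrow> sgn_uniform \<P>"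
    and "finite \<F>" "\<F> \<subseteq> param_poly (Suc N)" "finite \<P>" "\<P> \<subseteq> param_poly N"
  shows "sgn_uniform (\<F> \<union> \<P>)"
  using assms(2-)
proof (induction \<F> arbitrary: \<P> rule: finite_induct)
  case empty
  then show ?case using low by simp
next
  case (insert f \<F>)
  define f' where "f' = (\<lambda>x. pderiv (f x))"
  have f': "f' \<in> param_poly N" using pderiv_param_poly insert.prems(1) by (auto simp: f'_def)
  define \<G> where "\<G> = insert f' (\<F> \<union> \<P>)"
  have \<G>: "finite \<G>" "insert f \<G> \<subseteq> param_poly (Suc N)"
    using insert f' param_poly_mono[of N "Suc N"] by (auto simp: \<G>_def)
  have "\<exists>r\<in>param_poly k. sgn_remainder k f g r" if "g \<in> \<G>" for g k
    using sgn_remainder_exists \<G>(2) that by blast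
  then obtain r where r: "\<And>g k. g \<in> \<G> \<Longrightarrow> r g k \<in> param_poly k"
      "\<And>g k. g \<in> \<G> \<Longrightarrow> sgn_remainder k f g (r g k)"
    by metis
  define \<R> where "\<R> = (\<lambda>(g, k). r g k) ` (\<G> \<times> {..N})"
  have "\<R> \<subseteq> param_poly N" using r(1) param_poly_mono by (fastforce simp: \<R>_def)
  then have "sgn_uniform (\<F> \<union> (insert f' \<P> \<union> \<R>))"
    using insert f' \<G>(1) by (intro insert.IH) (auto simp: \<R>_def)
  also have "\<F> \<union> (insert f' \<P> \<union> \<R>) = \<G> \<union> \<R>" by (auto simp: \<G>_def)
  finally have "sgn_uniform (\<G> \<union> \<R>)" .
  moreover have "\<exists>s\<in>\<R>. sgn_remainder k f g s" if "g \<in> \<G>" "k < Suc N" for g k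
    using r(2)[OF that(1)] that by (intro bexI[of _ "r g k"]) (auto simp: \<R>_def)
  ultimately have "sgn_uniform (insert f \<G>)"
    using \<G> by (intro sgn_uniform_insert[of \<G> f "Suc N" \<R>]) (auto simp: \<G>_def f'_def)
  then show ?case by (rule sgn_uniform_subset) (auto simp: \<G>_def)
qed

lemma sgn_uniform_param_poly:
  "finite \<P> \<Longrightarrow> \<P> \<subseteq> param_poly N \<Longrightarrow> sgn_uniform \<P>"
proof (induction N arbitrary: \<P>)
  case 0
  then have "P x = 0" if "P \<in> \<P>" for P x
    using that by (auto simp: param_poly_def poly_eq_iff)
  then have "(\<lambda>P. (P x, P y)) ` \<P> \<subseteq> {(0, 0)}" for x y by blast
  moreover have "matches_signs id {(0, 0)}" by (simp add: matches_signs_def strict_mono_def)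
  ultimately have "matches_signs id ((\<lambda>P. (P x, P y)) ` \<P>)" for x y
    using matches_signs_subset by blast
  then show ?case unfolding sgn_uniform_def by blast
next
  case (Suc N)
  show ?case using sgn_uniform_Un[OF Suc.IH Suc.prems, of "{}"] by simp
qed

section \<open>The Tarski--Seidenberg theorem\<close>

lemma basic_semialgebraic_same_sgns:
  assumes "finite Q" "Q \<subseteq> poly_fun"
  shows "basic_semialgebraic {y. same_sgns Q x y}"
proof -
  define f where "f y = (\<Sum>q\<in>{q\<in>Q. q x = 0}. (q y)\<^sup>2)" for y
  define G where "G = {q\<in>Q. q x > 0} \<union> (\<lambda>q y. - q y) ` {q\<in>Q. q x < 0}"
  have "finite G" using assms by (simp add: G_def)
  then obtain gs where gs: "set gs = G" using finite_list by blast
  have "f \<in> poly_fun" unfolding f_def[abs_def] using assms by (intro poly_fun_intros) auto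
  moreover have "g \<in> poly_fun" if "g \<in> set gs" for g
    using that assms by (auto simp: gs G_def intro: poly_fun_uminus)
  moreover have "f y = 0 \<longleftrightarrow> (\<forall>q\<in>Q. q x = 0 \<longrightarrow> q y = 0)" for y
    unfolding f_def using assms by (subst sum_nonneg_eq_0_iff) auto
  moreover have "(\<forall>g\<in>set gs. g y > 0) \<longleftrightarrow> (\<forall>q\<in>Q. (q x > 0 \<longrightarrow> q y > 0) \<and> (q x < 0 \<longrightarrow> q y < 0))" for y
    by (simp add: gs G_def ball_Un) blast
  moreover have "sgn (q x) = sgn (q y) \<longleftrightarrow>
      (q x = 0 \<longrightarrow> q y = 0) \<and> (q x > 0 \<longrightarrow> q y > 0) \<and> (q x < 0 \<longrightarrow> q y < 0)" for q :: "'a \<Rightarrow> real" and y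
    by (auto simp: sgn_if)
  ultimately show ?thesis
    unfolding basic_semialgebraic_def same_sgns_def
    by (intro exI[of _ f] exI[of _ gs]) auto
qed

lemma semialgebraicI_same_sgns:
  assumes Q: "finite Q" "Q \<subseteq> poly_fun" and S: "\<And>x y. same_sgns Q x y \<Longrightarrow> x \<in> S \<Longrightarrow> y \<in> S"
  shows "semialgebraic S"
proof -
  let ?cell = "\<lambda>x. {y. same_sgns Q x y}"
  define sgns where "sgns x = restrict (\<lambda>q. sgn (q x)) Q" for x
  have "sgns x \<in> Q \<rightarrow>\<^sub>E {-1, 0, 1}" for x by (auto simp: sgns_def sgn_if)
  then have "finite (sgns ` S)"
    using Q(1) by (intro finite_subset[OF _ finite_PiE[of Q "\<lambda>_. {-1, 0, 1}"]]) auto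
  moreover have "?cell x = {y. \<forall>q\<in>Q. sgns x q = sgn (q y)}" for x
    by (auto simp: sgns_def same_sgns_def)
  then have "?cell ` S = (\<lambda>p. {y. \<forall>q\<in>Q. p q = sgn (q y)}) ` sgns ` S"
    by (simp add: image_image)
  ultimately have "finite (?cell ` S)" by simp
  moreover have "S = \<Union>(?cell ` S)" using S by (auto simp: same_sgns_def)
  ultimately show ?thesis
    unfolding semialgebraic_def using basic_semialgebraic_same_sgns[OF Q]
    by (intro exI[of _ "?cell ` S"]) blast
qed

lemma basic_semialgebraicE_same_sgns:
  assumes "basic_semialgebraic A"
  obtains Q where "finite Q" "Q \<subseteq> poly_fun" "\<And>x y. same_sgns Q x y \<Longrightarrow> x \<in> A \<longleftrightarrow> y \<in> A"
proof -
  obtain f gs where fgs: "f \<in> poly_fun" "\<forall>g\<in>set gs. g \<in> poly_fun"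
      "A = {x. f x = 0 \<and> (\<forall>g\<in>set gs. g x > 0)}"
    using assms unfolding basic_semialgebraic_def by blast
  show ?thesis
  proof (rule that[of "insert f (set gs)"])
    fix x y assume xy: "same_sgns (insert f (set gs)) x y"
    have "f x = 0 \<longleftrightarrow> f y = 0" using same_sgnsD[OF xy, of f] by (metis insertI1 sgn_0_0)
    moreover have "g x > 0 \<longleftrightarrow> g y > 0" if "g \<in> set gs" for g
      using same_sgnsD[OF xy, of g] that by (metis insertI2 sgn_greater)
    ultimately show "x \<in> A \<longleftrightarrow> y \<in> A" by (simp add: fgs(3))
  qed (use fgs(1,2) in auto)
qed

lemma semialgebraicE_same_sgns:
  assumes "semialgebraic S"
  obtains Q where "finite Q" "Q \<subseteq> poly_fun" "\<And>x y. same_sgns Q x y \<Longrightarrow> x \<in> S \<longleftrightarrow> y \<in> S"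
proof -
  obtain \<A> where \<A>: "finite \<A>" "\<And>A. A \<in> \<A> \<Longrightarrow> basic_semialgebraic A" "S = \<Union>\<A>"
    using assms by (auto simp: semialgebraic_def)
  have "\<exists>Q. finite Q \<and> Q \<subseteq> poly_fun \<and> (\<forall>x y. same_sgns Q x y \<longrightarrow> (x \<in> A \<longleftrightarrow> y \<in> A))"
    if "A \<in> \<A>" for A
    using \<A>(2)[OF that] by (metis basic_semialgebraicE_same_sgns)
  then obtain Q where Q: "\<And>A. A \<in> \<A> \<Longrightarrow> finite (Q A) \<and> Q A \<subseteq> poly_fun"
      "\<And>A x y. A \<in> \<A> \<Longrightarrow> same_sgns (Q A) x y \<Longrightarrow> x \<in> A \<longleftrightarrow> y \<in> A"
    by metis
  show ?thesis
  proof (rule that[of "\<Union>(Q ` \<A>)"])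
    show "x \<in> S \<longleftrightarrow> y \<in> S" if "same_sgns (\<Union>(Q ` \<A>)) x y" for x y
      using Q(2) same_sgns_mono[OF that] unfolding \<A>(3) by blast
  qed (use \<A>(1) Q(1) in auto)
qed

lemma semialgebraic_Compl: "semialgebraic S \<Longrightarrow> semialgebraic (- S)"
  by (metis ComplD ComplI semialgebraicE_same_sgns semialgebraicI_same_sgns)

lemma semialgebraic_Int:
  assumes "semialgebraic S" "semialgebraic T" shows "semialgebraic (S \<inter> T)"
proof -
  obtain Q R where Q: "finite Q" "Q \<subseteq> poly_fun" "\<And>x y. same_sgns Q x y \<Longrightarrow> x \<in> S \<longleftrightarrow> y \<in> S"
    and R: "finite R" "R \<subseteq> poly_fun" "\<And>x y. same_sgns R x y \<Longrightarrow> x \<in> T \<longleftrightarrow> y \<in> T"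
    using assms by (metis semialgebraicE_same_sgns)
  show ?thesis
  proof (rule semialgebraicI_same_sgns[of "Q \<union> R"])
    show "y \<in> S \<inter> T" if "same_sgns (Q \<union> R) x y" "x \<in> S \<inter> T" for x y
      using that Q(3)[of x y] R(3)[of x y] by (auto intro: same_sgns_mono)
  qed (use Q R in auto)
qed

lemma semialgebraic_Collect_not: "semialgebraic {x. P x} \<Longrightarrow> semialgebraic {x. \<not> P x}"
  using semialgebraic_Compl by (fastforce simp: Collect_neg_eq)

lemma semialgebraic_Collect_conj:
  "semialgebraic {x. P x} \<Longrightarrow> semialgebraic {x. R x} \<Longrightarrow> semialgebraic {x. P x \<and> R x}"
  using semialgebraic_Int by (fastforce simp: Collect_conj_eq)

lemma semialgebraic_Collect_imp:
  "semialgebraic {x. P x} \<Longrightarrow> semialgebraic {x. R x} \<Longrightarrow> semialgebraic {x. P x \<longrightarrow> R x}"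
  using semialgebraic_Collect_not[OF semialgebraic_Collect_conj[of P "\<lambda>x. \<not> R x"]]
    semialgebraic_Collect_not[of R] by simp

lemma semialgebraic_Collect_pos: "p \<in> poly_fun \<Longrightarrow> semialgebraic {x. p x > 0}"
  by (rule semialgebraicI_same_sgns[of "{p}"]) (auto simp: same_sgns_def sgn_if split: if_splits)

lemma semialgebraic_Collect_eq_0: "p \<in> poly_fun \<Longrightarrow> semialgebraic {x. p x = 0}"
  by (rule semialgebraicI_same_sgns[of "{p}"]) (auto simp: same_sgns_def sgn_if split: if_splits)

definition poly_map :: "('a::euclidean_space \<Rightarrow> 'b::euclidean_space) \<Rightarrow> bool" where
  "poly_map h \<longleftrightarrow> (\<forall>b\<in>Basis. (\<lambda>x. h x \<bullet> b) \<in> poly_fun)"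

lemma poly_fun_compose:
  assumes "p \<in> poly_fun" "poly_map h"
  shows "(\<lambda>x. p (h x)) \<in> poly_fun"
  using assms(1) by induction (use assms(2) in \<open>auto simp: poly_map_def intro: poly_fun.intros\<close>)

lemma poly_map_linear:
  fixes h :: "'a::euclidean_space \<Rightarrow> 'b::euclidean_space"
  assumes h: "linear h"
  shows "poly_map h"
proof -
  have "(\<lambda>x. h x \<bullet> b) = (\<lambda>x. \<Sum>i\<in>Basis. (x \<bullet> i) * (h i \<bullet> b))" for b
  proof
    fix x
    have "h x = (\<Sum>i\<in>Basis. (x \<bullet> i) *\<^sub>R h i)"
      using linear_sum[OF h, of "\<lambda>i. (x \<bullet> i) *\<^sub>R i" Basis] linear_scale[OF h]
      by (simp add: euclidean_representation)
    then show "h x \<bullet> b = (\<Sum>i\<in>Basis. (x \<bullet> i) * (h i \<bullet> b))" by (simp add: inner_sum_left)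
  qed
  then show ?thesis
    by (auto simp: poly_map_def intro!: poly_fun_sum poly_fun.mult poly_fun.coord poly_fun.const)
qed

lemma poly_fun_linear: "linear f \<Longrightarrow> f \<in> poly_fun"
  using poly_map_linear[of f] by (simp add: poly_map_def)

lemma semialgebraic_vimage:
  assumes "semialgebraic S" and h: "poly_map h"
  shows "semialgebraic {x. h x \<in> S}"
proof -
  obtain Q where Q: "finite Q" "Q \<subseteq> poly_fun" "\<And>x y. same_sgns Q x y \<Longrightarrow> x \<in> S \<longleftrightarrow> y \<in> S"
    using assms(1) by (metis semialgebraicE_same_sgns)
  show ?thesis
  proof (rule semialgebraicI_same_sgns[of "(\<lambda>q x. q (h x)) ` Q"])
    show "y \<in> {x. h x \<in> S}" if "same_sgns ((\<lambda>q x. q (h x)) ` Q) x y" "x \<in> {x. h x \<in> S}" for x y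
      using that Q(3)[of "h x" "h y"] by (simp add: same_sgns_def)
  qed (use Q(1,2) poly_fun_compose[OF _ h] in auto)
qed

lemma poly_fun_on_line:
  assumes "p \<in> poly_fun"
  shows "\<exists>n. \<exists>P\<in>param_poly n. \<forall>z t. p (z + t *\<^sub>R v) = poly (P z) t"
  using assms
proof induction
  case (const c)
  have "(\<lambda>x. [:c:]) \<in> param_poly 1"
    by (auto simp: param_poly_def coeff_pCons intro: poly_fun_intros split: nat.splits)
  then show ?case by (intro exI bexI[rotated]) auto
next
  case (coord b)
  have "(\<lambda>x. coeff [:x \<bullet> b, v \<bullet> b:] i) \<in> poly_fun" for i
    by (cases i) (auto simp: coeff_pCons intro: poly_fun_intros coord split: nat.splits)
  then have "(\<lambda>x. [:x \<bullet> b, v \<bullet> b:]) \<in> param_poly 2"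
    by (intro param_polyI) (auto simp: coeff_pCons split: nat.splits)
  then show ?case by (intro exI bexI[rotated]) (auto simp: inner_add_left)
next
  case (add p q)
  then obtain m n P R where "P \<in> param_poly m" "R \<in> param_poly n"
    "\<forall>z t. p (z + t *\<^sub>R v) = poly (P z) t" "\<forall>z t. q (z + t *\<^sub>R v) = poly (R z) t" by blast
  then show ?case
    by (intro exI[of _ "max m n"] bexI[of _ "\<lambda>z. P z + R z"] param_poly_add) simp_all
next
  case (mult p q)
  then obtain m n P R where "P \<in> param_poly m" "R \<in> param_poly n"
    "\<forall>z t. p (z + t *\<^sub>R v) = poly (P z) t" "\<forall>z t. q (z + t *\<^sub>R v) = poly (R z) t" by blast
  then show ?case
    by (intro exI[of _ "m + n"] bexI[of _ "\<lambda>z. P z * R z"] param_poly_mult) simp_all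
qed

lemma mem_add_span_singleton:
  fixes v :: "'a::real_vector"
  shows "z \<in> S + span {v} \<longleftrightarrow> (\<exists>t. z + t *\<^sub>R v \<in> S)"
proof
  assume "z \<in> S + span {v}"
  then obtain s t where "s \<in> S" "z = s + t *\<^sub>R v"
    by (auto elim!: set_plus_elim simp: span_singleton)
  then have "z + (- t) *\<^sub>R v \<in> S" by simp
  then show "\<exists>t. z + t *\<^sub>R v \<in> S" by blast
next
  assume "\<exists>t. z + t *\<^sub>R v \<in> S"
  then obtain t where "z + t *\<^sub>R v \<in> S" by blast
  then have "(z + t *\<^sub>R v) + (- t) *\<^sub>R v \<in> S + span {v}"
    by (intro set_plus_intro span_mul span_base) auto
  then show "z \<in> S + span {v}" by simp
qed

lemma add_span_insert: "S + span (insert v B) = (S + span B) + span {v}"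
proof -
  have "span (insert v B) = span B + span {v}"
    using span_Un[of B "{v}"] by (auto simp: set_plus_def)
  then show ?thesis by (simp add: add.assoc)
qed

lemma semialgebraic_add_line:
  fixes S :: "'a::euclidean_space set"
  assumes "semialgebraic S"
  shows "semialgebraic (S + span {v})"
proof -
  obtain Q where Q: "finite Q" "Q \<subseteq> poly_fun" "\<And>x y. same_sgns Q x y \<Longrightarrow> x \<in> S \<longleftrightarrow> y \<in> S"
    using assms by (metis semialgebraicE_same_sgns)
  have "\<forall>q\<in>Q. \<exists>n P. P \<in> param_poly n \<and> (\<forall>z t. q (z + t *\<^sub>R v) = poly (P z) t)"
    using poly_fun_on_line Q(2) by blast
  then obtain n P where P: "\<And>q. q \<in> Q \<Longrightarrow> P q \<in> param_poly (n q)"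
      "\<And>q z t. q \<in> Q \<Longrightarrow> q (z + t *\<^sub>R v) = poly (P q z) t" by metis
  have "P q \<in> param_poly (Max (n ` Q))" if "q \<in> Q" for q
    using P(1)[OF that] param_poly_mono[of "n q" "Max (n ` Q)"] Q(1) that by auto
  then have "sgn_uniform (P ` Q)" using Q(1) by (intro sgn_uniform_param_poly) auto
  then obtain R where R: "finite R" "R \<subseteq> poly_fun"
      "\<And>x y. same_sgns R x y \<Longrightarrow> \<exists>\<phi>. matches_signs \<phi> ((\<lambda>P. (P x, P y)) ` P ` Q)"
    unfolding sgn_uniform_def by blast
  show ?thesis
  proof (rule semialgebraicI_same_sgns[OF R(1,2)])
    fix x y assume "same_sgns R x y" "x \<in> S + span {v}"
    then obtain \<phi> t where \<phi>: "matches_signs \<phi> ((\<lambda>P. (P x, P y)) ` P ` Q)" and t: "x + t *\<^sub>R v \<in> S"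
      using R(3) unfolding mem_add_span_singleton by blast
    have "sgn (q (x + t *\<^sub>R v)) = sgn (q (y + \<phi> t *\<^sub>R v))" if "q \<in> Q" for q
      using matches_signsD(3)[OF \<phi>] that by (auto simp: P(2))
    then have "y + \<phi> t *\<^sub>R v \<in> S" using Q(3) t by (auto simp: same_sgns_def)
    then show "y \<in> S + span {v}" by (auto simp: mem_add_span_singleton)
  qed
qed

lemma semialgebraic_add_span:
  fixes S :: "'a::euclidean_space set"
  assumes "finite B" "semialgebraic S"
  shows "semialgebraic (S + span B)"
  using assms(1)
proof induction
  case empty
  then show ?case using assms(2) by simp
next
  case (insert v B)
  then show ?case by (subst add_span_insert) (rule semialgebraic_add_line)
qed

theorem semialgebraic_projection:
  fixes S :: "('a::euclidean_space \<times> 'b::euclidean_space) set"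
  assumes "semialgebraic S"
  shows "semialgebraic {x. \<exists>y. (x, y) \<in> S}"
proof -
  let ?V = "span (Pair 0 ` Basis) :: ('a \<times> 'b) set"
  have "linear (Pair 0 :: 'b \<Rightarrow> 'a \<times> 'b)" by (simp add: linear_iff)
  then have V: "?V = range (Pair 0)" by (simp add: linear_span_image)
  have "(x, 0) \<in> S + ?V \<longleftrightarrow> (\<exists>y. (x, y) \<in> S)" for x
  proof
    assume "(x, 0) \<in> S + ?V"
    then show "\<exists>y. (x, y) \<in> S" unfolding V by (auto simp: set_plus_def)
  next
    assume "\<exists>y. (x, y) \<in> S"
    then obtain y where "(x, y) \<in> S" by blast
    then have "(x, y) + (0, - y) \<in> S + ?V" unfolding V by (intro set_plus_intro rangeI)
    then show "(x, 0) \<in> S + ?V" by simp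
  qed
  moreover have "poly_map (\<lambda>x::'a. (x, 0::'b))" by (intro poly_map_linear) (simp add: linear_iff)
  moreover have "semialgebraic (S + ?V)" using assms by (intro semialgebraic_add_span) auto
  ultimately show ?thesis using semialgebraic_vimage[of "S + ?V" "\<lambda>x. (x, 0)"] by simp
qed

lemma semialgebraic_Collect_ex:
  assumes "semialgebraic {(x, y). P x y}" shows "semialgebraic {x. \<exists>y. P x y}"
  using semialgebraic_projection[OF assms] by simp

lemma semialgebraic_Collect_all:
  assumes "semialgebraic {(x, y). P x y}" shows "semialgebraic {x. \<forall>y. P x y}"
  using semialgebraic_Collect_not[OF semialgebraic_Collect_ex[of "\<lambda>x y. \<not> P x y"]]
    semialgebraic_Collect_not[of "\<lambda>(x, y). P x y"] assms by (simp add: case_prod_unfold)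

lemma poly_map_diff: "poly_map f \<Longrightarrow> poly_map g \<Longrightarrow> poly_map (\<lambda>x. f x - g x)"
  by (auto simp: poly_map_def inner_diff_left intro: poly_fun_diff)

lemma poly_fun_norm_square:
  assumes "poly_map f"
  shows "(\<lambda>x. (norm (f x))\<^sup>2) \<in> poly_fun"
proof -
  have "(norm (f x))\<^sup>2 = (\<Sum>b\<in>Basis. (f x \<bullet> b)\<^sup>2)" for x
    unfolding power2_norm_eq_inner by (subst euclidean_inner) (simp add: power2_eq_square)
  then show ?thesis using assms by (auto simp: poly_map_def intro!: poly_fun_sum poly_fun_power)
qed

lemma semialgebraic_Collect_eq:
  assumes "poly_map f" "poly_map g"
  shows "semialgebraic {x. f x = g x}"
  using semialgebraic_Collect_eq_0[OF poly_fun_norm_square[OF poly_map_diff[OF assms]]] by simp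

lemma semialgebraic_Collect_dist_less:
  assumes "poly_map f" "poly_map g" "r \<in> poly_fun"
  shows "semialgebraic {x. dist (f x) (g x) < r x}"
proof -
  have "dist a b < c \<longleftrightarrow> c > 0 \<and> c\<^sup>2 - (norm (a - b))\<^sup>2 > 0" for a b :: 'b and c :: real
    using abs_le_square_iff[of c "norm (a - b)"] norm_ge_zero[of "a - b"]
    unfolding dist_norm by linarith
  moreover have "(\<lambda>x. (r x)\<^sup>2 - (norm (f x - g x))\<^sup>2) \<in> poly_fun"
    using assms by (intro poly_fun_diff poly_fun_power poly_fun_norm_square poly_map_diff)
  ultimately show ?thesis
    using assms(3) by (simp only:) (intro semialgebraic_Collect_conj semialgebraic_Collect_pos)
qed

lemma semialgebraic_fibrewise_closure:
  fixes D :: "('a::euclidean_space \<times> 'b::euclidean_space) set"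
  assumes "semialgebraic D"
  shows "semialgebraic {(x, y). y \<in> closure {z. (x, z) \<in> D}}"
proof -
  let ?x = "\<lambda>p :: (('a \<times> 'b) \<times> real) \<times> 'b. fst (fst (fst p))"
    and ?y = "\<lambda>p :: (('a \<times> 'b) \<times> real) \<times> 'b. snd (fst (fst p))"
    and ?e = "\<lambda>p :: (('a \<times> 'b) \<times> real) \<times> 'b. snd (fst p)"
  have "semialgebraic {p. (?x p, snd p) \<in> D}"
    by (intro semialgebraic_vimage[OF assms] poly_map_linear) (simp add: linear_iff)
  moreover have "semialgebraic {p. dist (snd p) (?y p) < ?e p}"
    by (intro semialgebraic_Collect_dist_less poly_map_linear poly_fun_linear)
       (auto simp: linear_iff)
  ultimately have "semialgebraic {(((x, y), e), z). (x, z) \<in> D \<and> dist z y < e}"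
    using semialgebraic_Collect_conj by (fastforce simp: case_prod_unfold)
  then have "semialgebraic {((x, y), e). \<exists>z. (x, z) \<in> D \<and> dist z y < e}"
    using semialgebraic_Collect_ex[of "\<lambda>((x, y), e) z. (x, z) \<in> D \<and> dist z y < e"]
    by (simp add: case_prod_unfold)
  moreover have "semialgebraic {q :: ('a \<times> 'b) \<times> real. 0 < snd q}"
    by (intro semialgebraic_Collect_pos poly_fun_linear) (simp add: linear_iff)
  ultimately have "semialgebraic {((x, y), e). 0 < e \<longrightarrow> (\<exists>z. (x, z) \<in> D \<and> dist z y < e)}"
    using semialgebraic_Collect_imp by (fastforce simp: case_prod_unfold)
  then have "semialgebraic {(x, y). \<forall>e. 0 < e \<longrightarrow> (\<exists>z. (x, z) \<in> D \<and> dist z y < e)}"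
    using semialgebraic_Collect_all[of "\<lambda>(x, y) e. 0 < e \<longrightarrow> (\<exists>z. (x, z) \<in> D \<and> dist z y < e)"]
    by (simp add: case_prod_unfold)
  then show ?thesis by (simp add: closure_approachable Bex_def)
qed

lemma semialgebraic_fibrewise_closed:
  fixes D :: "('a::euclidean_space \<times> 'b::euclidean_space) set"
  assumes "semialgebraic D"
  shows "semialgebraic {x. closed {y. (x, y) \<in> D}}"
proof -
  have "semialgebraic {(x, y). y \<in> closure {z. (x, z) \<in> D} \<longrightarrow> (x, y) \<in> D}"
    using semialgebraic_Collect_imp[of "\<lambda>(x, y). y \<in> closure {z. (x, z) \<in> D}" "\<lambda>p. p \<in> D"]
      semialgebraic_fibrewise_closure[OF assms] assms by (simp add: case_prod_unfold)
  then have "semialgebraic {x. closure {z. (x, z) \<in> D} \<subseteq> {z. (x, z) \<in> D}}"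
    using semialgebraic_Collect_all by (fastforce simp: subset_iff)
  then show ?thesis by (simp add: closure_subset_eq)
qed

section \<open>Sums of closed semialgebraic sets and generic subspaces\<close>

lemma continuous_on_poly_fun: "p \<in> poly_fun \<Longrightarrow> continuous_on S p"
  by (induction rule: poly_fun.induct) (auto intro: continuous_intros)

lemma poly_fun_nonzero_dense:
  assumes p: "p \<in> poly_fun" "p a \<noteq> 0" and U: "open U" "U \<noteq> {}"
  shows "\<exists>x\<in>U. p x \<noteq> 0"
proof (rule ccontr)
  assume "\<not> ?thesis"
  then have zero: "p x = 0" if "x \<in> U" for x using that by blast
  obtain u where "u \<in> U" using U(2) by blast
  obtain n P where P: "\<And>z t. p (z + t *\<^sub>R (a - u)) = poly (P z) t"
    using poly_fun_on_line[OF p(1), of "a - u"] by blast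
  have "open ((\<lambda>t. u + t *\<^sub>R (a - u)) -` U)"
    using U(1) by (intro open_vimage continuous_intros)
  then obtain e where e: "e > 0" "ball 0 e \<subseteq> (\<lambda>t. u + t *\<^sub>R (a - u)) -` U"
    using \<open>u \<in> U\<close> by (force simp: open_contains_ball)
  have "poly (P u) t = 0" if "t \<in> ball 0 e" for t
    using zero[of "u + t *\<^sub>R (a - u)"] e(2) that by (auto simp: P)
  then have "ball 0 e \<subseteq> {t. poly (P u) t = 0}" by blast
  moreover have "infinite (ball (0 :: real) e)"
    using e(1) by (simp add: ball_eq_greaterThanLessThan infinite_Ioo)
  ultimately have "P u = 0" using poly_roots_finite finite_subset by blast
  then show False using P[of u 1] p(2) by simp
qed

lemma poly_fun_prod_nonzero:
  assumes "finite I" "\<And>i. i \<in> I \<Longrightarrow> p i \<in> poly_fun" "\<And>i. i \<in> I \<Longrightarrow> \<exists>x. p i x \<noteq> 0"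
  shows "\<exists>x. (\<Prod>i\<in>I. p i x) \<noteq> 0"
  using assms
proof (induction I)
  case empty
  then show ?case by simp
next
  case (insert i I)
  then obtain a b where a: "p i a \<noteq> 0" and b: "(\<Prod>i\<in>I. p i b) \<noteq> 0" by blast
  have "(\<lambda>x. \<Prod>i\<in>I. p i x) \<in> poly_fun" using insert.prems(1) by (intro poly_fun_prod) blast
  moreover have "open {x. p i x \<noteq> 0}"
    using insert.prems(1) by (intro open_Collect_neq continuous_on_poly_fun poly_fun.const) auto
  ultimately obtain x where "p i x \<noteq> 0" "(\<Prod>i\<in>I. p i x) \<noteq> 0"
    using poly_fun_nonzero_dense[of _ b "{x. p i x \<noteq> 0}"] a b by blast
  then show ?case using insert.hyps by auto
qed

lemma not_frontier_if_eventually_const: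
  assumes "\<forall>\<^sub>F y in nhds x. y \<in> Y \<longleftrightarrow> x \<in> Y"
  shows "x \<notin> frontier Y"
proof -
  obtain U where U: "open U" "x \<in> U" "\<And>y. y \<in> U \<Longrightarrow> y \<in> Y \<longleftrightarrow> x \<in> Y"
    using assms unfolding eventually_nhds by blast
  then consider "U \<subseteq> Y" | "U \<subseteq> - Y" by blast
  then have "x \<in> interior Y \<or> x \<in> interior (- Y)" using U(1,2) by cases (auto intro: interiorI)
  then show ?thesis by (auto simp: frontier_def closure_interior)
qed

lemma frontier_semialgebraic_subset_zeros:
  assumes "semialgebraic Y"
  obtains f where "f \<in> poly_fun" "\<exists>x. f x \<noteq> 0" "frontier Y \<subseteq> {x. f x = 0}"
proof -
  obtain Q where Q: "finite Q" "Q \<subseteq> poly_fun" "\<And>x y. same_sgns Q x y \<Longrightarrow> x \<in> Y \<longleftrightarrow> y \<in> Y"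
    using assms by (metis semialgebraicE_same_sgns)
  define R where "R = {q\<in>Q. \<exists>x. q x \<noteq> 0}"
  have R: "finite R" "\<And>q. q \<in> R \<Longrightarrow> q \<in> poly_fun" using Q(1,2) by (auto simp: R_def)
  have "x \<notin> frontier Y" if "(\<Prod>q\<in>R. q x) \<noteq> 0" for x
  proof (rule not_frontier_if_eventually_const)
    have "\<forall>\<^sub>F y in nhds x. sgn (q x) = sgn (q y)" if "q \<in> Q" for q
    proof (cases "q \<in> R")
      case True
      then have "q x \<noteq> 0" using \<open>(\<Prod>q\<in>R. q x) \<noteq> 0\<close> R(1) by simp
      have "(q \<longlongrightarrow> q x) (nhds x)"
        using continuous_on_poly_fun[OF R(2)[OF True], of UNIV]
        by (simp add: continuous_on_eq_continuous_at isCont_def tendsto_at_iff_tendsto_nhds)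
      then show ?thesis
        using \<open>q x \<noteq> 0\<close> order_tendstoD[of q "q x" "nhds x" 0]
        by (cases "q x > 0") (auto elim: eventually_mono)
    next
      case False
      then show ?thesis using that by (auto simp: R_def)
    qed
    then have "\<forall>\<^sub>F y in nhds x. same_sgns Q x y"
      unfolding same_sgns_def using Q(1) by (intro eventually_ball_finite) auto
    then show "\<forall>\<^sub>F y in nhds x. y \<in> Y \<longleftrightarrow> x \<in> Y"
      by (rule eventually_mono) (use Q(3) in blast)
  qed
  then have "frontier Y \<subseteq> {x. (\<Prod>q\<in>R. q x) = 0}" by blast
  moreover have "\<exists>x. (\<Prod>q\<in>R. q x) \<noteq> 0"
    using R by (intro poly_fun_prod_nonzero) (auto simp: R_def)
  ultimately show ?thesis using that poly_fun_prod[of R "\<lambda>q. q"] R(2) by blast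
qed

lemma poly_fun_homogenization:
  assumes "p \<in> poly_fun"
  shows "\<exists>d. \<exists>H\<in>poly_fun. \<forall>s x. H (s, s *\<^sub>R x) = s ^ d * p x"
  using assms
proof induction
  case (const c)
  show ?case by (intro exI[of _ 0] bexI[of _ "\<lambda>_. c"]) (auto intro: poly_fun.const)
next
  case (coord b)
  have "(\<lambda>z :: real \<times> 'a. z \<bullet> (0, b)) \<in> poly_fun"
    using coord by (intro poly_fun.coord) (auto simp: Basis_prod_def)
  then show ?case by (intro exI[of _ 1] bexI[of _ "\<lambda>z. z \<bullet> (0, b)"]) auto
next
  case (add p q)
  then obtain d H e K where H: "H \<in> poly_fun" "\<And>s x. H (s, s *\<^sub>R x) = s ^ d * p x"
    and K: "K \<in> poly_fun" "\<And>s x. K (s, s *\<^sub>R x) = s ^ e * q x" by metis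
  have "(\<lambda>z. fst z ^ e * H z + fst z ^ d * K z) \<in> poly_fun"
    using poly_fun_linear[OF linear_fst] H(1) K(1)
    by (intro poly_fun.add poly_fun.mult poly_fun_power)
  then show ?case
    by (intro exI[of _ "d + e"] bexI[of _ "\<lambda>z. fst z ^ e * H z + fst z ^ d * K z"])
       (auto simp: H(2) K(2) power_add algebra_simps)
next
  case (mult p q)
  then obtain d H e K where H: "H \<in> poly_fun" "\<And>s x. H (s, s *\<^sub>R x) = s ^ d * p x"
    and K: "K \<in> poly_fun" "\<And>s x. K (s, s *\<^sub>R x) = s ^ e * q x" by metis
  show ?case
    using poly_fun.mult[OF H(1) K(1)]
    by (intro exI[of _ "d + e"] bexI[of _ "\<lambda>z. H z * K z"])
       (auto simp: H(2) K(2) power_add algebra_simps)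
qed

lemma poly_fun_eval_param_poly:
  assumes P: "P \<in> param_poly n" and "g \<in> poly_fun"
  shows "(\<lambda>x. poly (P x) (g x)) \<in> poly_fun"
proof -
  have "poly (P x) t = (\<Sum>i<n. coeff (P x) i * t ^ i)" for x t
    unfolding poly_altdef
    using degree_param_poly_less[OF P, of x] param_polyD(2)[OF P]
    by (cases "P x = 0") (auto intro!: sum.mono_neutral_left intro: le_degree)
  then show ?thesis using assms by (auto simp: intro!: poly_fun_intros param_polyD(1)[OF P])
qed

lemma param_poly_compose: "P \<in> param_poly n \<Longrightarrow> poly_map h \<Longrightarrow> (\<lambda>x. P (h x)) \<in> param_poly n"
  by (auto simp: param_poly_def dest: poly_fun_compose)

lemma poly_shift_param_poly: "P \<in> param_poly n \<Longrightarrow> (\<lambda>x. poly_shift j (P x)) \<in> param_poly n"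
  by (simp add: param_poly_def coeff_poly_shift)

text \<open>
  The leading form of \<open>p\<close> is \<open>\<lambda>x. H (0, x)\<close>, once the homogenization \<open>H\<close> is divided by the
  largest possible power of the homogenizing variable.
\<close>

lemma poly_fun_reduced_homogenization:
  assumes p: "p \<in> poly_fun" "p x0 \<noteq> 0"
  obtains H d j where "H \<in> poly_fun" "\<exists>x. H (0, x) \<noteq> 0"
    "\<And>s x. s ^ j * H (s, s *\<^sub>R x) = s ^ d * p x"
proof -
  obtain d K where K: "K \<in> poly_fun" "\<And>s x. K (s, s *\<^sub>R x) = s ^ d * p x"
    using poly_fun_homogenization[OF p(1)] by blast
  obtain n P where P: "P \<in> param_poly n" "\<And>z t. K (z + t *\<^sub>R (1, 0)) = poly (P z) t"
    using poly_fun_on_line[OF K(1)] by blast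
  define R where "R x = P (0, x)" for x
  have R: "K (s, x) = poly (R x) s" for s x using P(2)[of "(0, x)" s] by (simp add: R_def)
  have "poly_map (Pair 0 :: 'a \<Rightarrow> real \<times> 'a)" by (intro poly_map_linear) (simp add: linear_iff)
  then have "R \<in> param_poly n" unfolding R_def[abs_def] by (rule param_poly_compose[OF P(1)])
  have "poly (R x0) 1 \<noteq> 0" using K(2)[of 1 x0] p(2) by (simp add: R)
  then have "\<exists>i x. coeff (R x) i \<noteq> 0" by (metis leading_coeff_0_iff poly_0)
  then obtain j where j: "\<exists>x. coeff (R x) j \<noteq> 0" "\<And>i x. i < j \<Longrightarrow> coeff (R x) i = 0"
    using exists_least_iff[of "\<lambda>i. \<exists>x. coeff (R x) i \<noteq> 0"] by blast
  define H where "H z = poly (poly_shift j (R (snd z))) (fst z)" for z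
  have "R x = monom 1 j * poly_shift j (R x)" for x
    using j(2) by (simp add: poly_eq_iff coeff_monom_mult coeff_poly_shift)
  then have "poly (R x) s = s ^ j * H (s, x)" for s x
    unfolding H_def by (metis fst_conv mult.left_neutral poly_monom poly_mult snd_conv)
  then have "s ^ j * H (s, s *\<^sub>R x) = s ^ d * p x" for s x using K(2) R by simp
  moreover have "\<exists>x. H (0, x) \<noteq> 0"
    using j(1) by (simp add: H_def poly_0_coeff_0 coeff_poly_shift)
  moreover have "(\<lambda>z :: real \<times> 'a. poly_shift j (R (snd z))) \<in> param_poly n"
    using poly_shift_param_poly[OF \<open>R \<in> param_poly n\<close>] poly_map_linear[OF linear_snd]
    by (rule param_poly_compose)
  then have "H \<in> poly_fun"
    unfolding H_def[abs_def] using poly_fun_linear[OF linear_fst] by (rule poly_fun_eval_param_poly)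
  ultimately show ?thesis using that by blast
qed

lemma poly_fun_zeros_bounded_along_generic_direction:
  assumes p: "p \<in> poly_fun" "p x0 \<noteq> 0"
  obtains h where "h \<in> poly_fun" "\<exists>v. h v \<noteq> 0"
    "\<And>v r. h v \<noteq> 0 \<Longrightarrow> \<exists>m. \<forall>x t. norm x \<le> r \<longrightarrow> p (x + t *\<^sub>R v) = 0 \<longrightarrow> \<bar>t\<bar> \<le> m"
proof -
  obtain H d j where H: "H \<in> poly_fun" "\<exists>v. H (0, v) \<noteq> 0"
      "\<And>s x. s ^ j * H (s, s *\<^sub>R x) = s ^ d * p x"
    using poly_fun_reduced_homogenization[OF p] by metis
  have bounded: "\<exists>m. \<forall>x t. norm x \<le> r \<longrightarrow> p (x + t *\<^sub>R v) = 0 \<longrightarrow> \<bar>t\<bar> \<le> m" if v: "H (0, v) \<noteq> 0" for v r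
  proof -
    have "isCont H (0, v)"
      using continuous_on_poly_fun[OF H(1), of UNIV] by (simp add: continuous_on_eq_continuous_at)
    then obtain \<delta> where \<delta>: "\<delta> > 0" "\<And>z. dist (0, v) z < \<delta> \<Longrightarrow> H z \<noteq> 0"
      using continuous_at_avoid[of "(0, v)" H 0] v by auto
    have "\<bar>t\<bar> \<le> (1 + \<bar>r\<bar>) / \<delta>" if "norm x \<le> r" "p (x + t *\<^sub>R v) = 0" for x t
    proof (rule ccontr)
      assume large: "\<not> \<bar>t\<bar> \<le> (1 + \<bar>r\<bar>) / \<delta>"
      then have "t \<noteq> 0" using \<delta>(1) by auto
      have "dist (0, v) (1 / t, x /\<^sub>R t + v) = norm (1 / t, x /\<^sub>R t)"
        by (simp add: dist_Pair_Pair dist_norm norm_Pair)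
      also have "\<dots> \<le> norm (1 / t) + norm (x /\<^sub>R t)" by (rule norm_Pair_le)
      also have "\<dots> = (1 + norm x) / \<bar>t\<bar>" by (simp add: divide_simps)
      also have "\<dots> \<le> (1 + \<bar>r\<bar>) / \<bar>t\<bar>" using that(1) by (intro divide_right_mono) auto
      also have "\<dots> < \<delta>" using large \<delta>(1) \<open>t \<noteq> 0\<close> by (simp add: field_simps)
      finally have "H (1 / t, x /\<^sub>R t + v) \<noteq> 0" by (rule \<delta>(2))
      moreover have "(1 / t) *\<^sub>R (x + t *\<^sub>R v) = x /\<^sub>R t + v"
        using \<open>t \<noteq> 0\<close> by (simp add: scaleR_add_right inverse_eq_divide)
      ultimately show False
        using H(3)[of "1 / t" "x + t *\<^sub>R v"] that(2) \<open>t \<noteq> 0\<close> by simp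
    qed
    then show ?thesis by blast
  qed
  have "(\<lambda>v. H (0, v)) \<in> poly_fun"
    by (intro poly_fun_compose[OF H(1)] poly_map_linear) (simp add: linear_iff)
  then show ?thesis using H(2) bounded by (rule that)
qed

lemma closed_set_plus_if_bounded_fibres:
  fixes D V :: "'a::euclidean_space set"
  assumes "closed D" "closed V" and bounded: "\<And>r. bounded {v\<in>V. \<exists>x\<in>D. norm (x + v) \<le> r}"
  shows "closed (D + V)"
  unfolding closed_sequential_limits
proof (intro allI impI, elim conjE)
  fix z l assume z: "\<forall>n. z n \<in> D + V" and "z \<longlonglongrightarrow> l"
  then obtain r where r: "\<And>n. norm (z n) \<le> r"
    using convergent_imp_Bseq[OF convergentI] by (metis BseqE)
  define W where "W = closure {v\<in>V. \<exists>x\<in>D. norm (x + v) \<le> r}"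
  have "closed (\<Union>x\<in>D. \<Union>w\<in>W. {x + w})"
    unfolding W_def using \<open>closed D\<close> bounded by (intro closed_compact_sums) auto
  also have "(\<Union>x\<in>D. \<Union>w\<in>W. {x + w}) = D + W" by (auto simp: set_plus_def)
  finally have "closed (D + W)" .
  moreover have "z n \<in> D + W" for n
  proof -
    obtain x v where "x \<in> D" "v \<in> V" "z n = x + v" using z by (metis set_plus_elim)
    then show ?thesis
      unfolding W_def using r[of n] by (auto intro!: set_plus_intro closure_subset[THEN subsetD])
  qed
  ultimately have "l \<in> D + W" using \<open>z \<longlonglongrightarrow> l\<close> closed_sequentially by blast
  moreover have "W \<subseteq> V" unfolding W_def using \<open>closed V\<close> by (intro closure_minimal) auto
  ultimately show "l \<in> D + V" by (metis order_refl set_plus_mono2 subsetD)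
qed

lemma disjoint_add_subspace:
  fixes S T V :: "'a::real_vector set"
  assumes V: "subspace V" and "(S + V) \<inter> T = {}"
  shows "S \<inter> (T + V) = {}"
proof -
  have "s \<noteq> t + v" if "s \<in> S" "t \<in> T" "v \<in> V" for s t v
  proof
    assume "s = t + v"
    then have "s + (- v) \<in> T" using \<open>t \<in> T\<close> by simp
    moreover have "s + (- v) \<in> S + V" using that subspace_neg[OF V] by (intro set_plus_intro)
    ultimately show False using assms(2) by blast
  qed
  then show ?thesis by (auto elim!: set_plus_elim)
qed

lemma closed_add_subspace_if_frontier:
  fixes Y V :: "'a::euclidean_space set"
  assumes Y: "closed Y" and V: "subspace V" and frontier: "closed (frontier Y + V)"
  shows "closed (Y + V)"
proof -
  have "\<exists>e>0. ball z e \<subseteq> - (Y + V)" if z: "z \<in> - (Y + V)" for z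
  proof -
    have "z \<notin> frontier Y + V"
      using z frontier_subset_closed[OF Y] set_plus_mono2[of "frontier Y" Y V V] by auto
    then obtain e where e: "e > 0" "ball z e \<inter> (frontier Y + V) = {}"
      using frontier by (metis ComplI disjoint_eq_subset_Compl open_Compl open_contains_ball)
    then have "(ball z e + V) \<inter> frontier Y = {}"
      using disjoint_add_subspace[OF V, of "frontier Y" "ball z e"] by (simp add: Int_commute)
    moreover have "z + 0 \<in> ball z e + V" using e(1) subspace_0[OF V] by (intro set_plus_intro) auto
    moreover have "z \<notin> Y" using z subspace_0[OF V] set_plus_intro[of z Y 0 V] by auto
    moreover have "connected (ball z e + V)"
      using V by (intro convex_connected convex_set_plus convex_ball subspace_imp_convex)
    ultimately have "(ball z e + V) \<inter> Y = {}"
      using connected_Int_frontier[of "ball z e + V" Y] by force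
    then have "ball z e \<subseteq> - (Y + V)" using disjoint_add_subspace[OF V] by blast
    then show ?thesis using e(1) by blast
  qed
  then have "open (- (Y + V))" unfolding open_contains_ball by blast
  then show ?thesis by (simp add: closed_def)
qed

lemma closed_add_line_generic:
  fixes Y :: "'a::euclidean_space set"
  assumes "closed Y" "semialgebraic Y" "open U" "U \<noteq> {}"
  shows "\<exists>v\<in>U. closed (Y + span {v})"
proof -
  obtain f x0 where f: "f \<in> poly_fun" "f x0 \<noteq> 0" "frontier Y \<subseteq> {x. f x = 0}"
    using frontier_semialgebraic_subset_zeros[OF assms(2)] by blast
  obtain h v0 where h: "h \<in> poly_fun" "h v0 \<noteq> 0"
    "\<And>v r. h v \<noteq> 0 \<Longrightarrow> \<exists>m. \<forall>x t. norm x \<le> r \<longrightarrow> f (x + t *\<^sub>R v) = 0 \<longrightarrow> \<bar>t\<bar> \<le> m"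
    using poly_fun_zeros_bounded_along_generic_direction[OF f(1,2)] by metis
  obtain v where v: "v \<in> U" "h v \<noteq> 0" using poly_fun_nonzero_dense[OF h(1,2) assms(3,4)] by blast
  have "bounded {w \<in> span {v}. \<exists>x\<in>frontier Y. norm (x + w) \<le> r}" for r
  proof -
    obtain m where m: "\<And>x t. norm x \<le> r \<Longrightarrow> f (x + t *\<^sub>R v) = 0 \<Longrightarrow> \<bar>t\<bar> \<le> m"
      using h(3)[OF v(2)] by blast
    have "norm w \<le> m * norm v"
      if w: "w \<in> span {v}" and x: "x \<in> frontier Y" "norm (x + w) \<le> r" for w x
    proof -
      obtain t where t: "w = t *\<^sub>R v" using w by (auto simp: span_singleton)
      then have "f ((x + w) + (- t) *\<^sub>R v) = 0" using f(3) x(1) by auto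
      then have "\<bar>t\<bar> \<le> m" using m[OF x(2), of "- t"] by simp
      then show ?thesis by (simp add: t mult_right_mono)
    qed
    then show ?thesis unfolding bounded_iff by blast
  qed
  then have "closed (frontier Y + span {v})"
    by (intro closed_set_plus_if_bounded_fibres frontier_closed closed_span)
  then show ?thesis
    using closed_add_subspace_if_frontier[OF assms(1) subspace_span] v(1) by blast
qed

lemma closed_add_span_generic:
  fixes Y :: "'a::euclidean_space set" and U :: "'i \<Rightarrow> 'a set"
  assumes "closed Y" "semialgebraic Y" "finite I" "\<And>i. i \<in> I \<Longrightarrow> open (U i) \<and> U i \<noteq> {}"
  shows "\<exists>v. (\<forall>i\<in>I. v i \<in> U i) \<and> closed (Y + span (v ` I))"
  using assms(3,4)
proof (induction I)
  case empty
  then show ?case using assms(1) by simp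
next
  case (insert j I)
  then obtain v where v: "\<forall>i\<in>I. v i \<in> U i" "closed (Y + span (v ` I))" by auto
  moreover have "semialgebraic (Y + span (v ` I))"
    using insert.hyps(1) assms(2) by (intro semialgebraic_add_span) auto
  ultimately obtain w where w: "w \<in> U j" "closed ((Y + span (v ` I)) + span {w})"
    using closed_add_line_generic[of "Y + span (v ` I)" "U j"] insert.prems by auto
  have "(v(j := w)) ` insert j I = insert w (v ` I)" using insert.hyps(2) by auto
  then have "closed (Y + span ((v(j := w)) ` insert j I))"
    using w(2) add_span_insert[of Y w "v ` I"] by simp
  moreover have "\<forall>i\<in>insert j I. (v(j := w)) i \<in> U i" using v(1) w(1) by simp
  ultimately show ?case by blast
qed

section \<open>Images under generic linear maps\<close>

lemma matrix_inv_inverse: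
  assumes "invertible A"
  shows "A ** matrix_inv A = mat 1" "matrix_inv A ** A = mat 1"
  using someI_ex[OF assms[unfolded invertible_def]] by (auto simp: matrix_inv_def)

lemma continuous_on_det: "continuous_on S (det :: real^'n^'n \<Rightarrow> real)"
  unfolding det_def by (intro continuous_intros)

lemma continuous_on_matrix_matrix_mult:
  fixes f :: "'a::topological_space \<Rightarrow> real^'n^'m" and g :: "'a \<Rightarrow> real^'k^'n"
  assumes "continuous_on S f" "continuous_on S g"
  shows "continuous_on S (\<lambda>x. f x ** g x)"
  unfolding matrix_matrix_mult_def by (intro continuous_intros assms)

lemma matrix_inv_cramer:
  fixes A :: "real^'n^'n"
  assumes "det A \<noteq> 0"
  shows "matrix_inv A = (\<chi> k j. det (\<chi> i l. if l = k then axis j 1 $ i else A $ i $ l) / det A)"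
proof -
  have "A ** matrix_inv A = mat 1"
    using assms by (intro matrix_inv_inverse) (simp add: invertible_det_nz)
  then have "A *v (matrix_inv A *v axis j 1) = axis j 1" for j
    by (simp add: matrix_vector_mul_assoc)
  then have "matrix_inv A *v axis j 1 =
      (\<chi> k. det (\<chi> i l. if l = k then axis j 1 $ i else A $ i $ l) / det A)" for j
    by (simp only: cramer[OF assms])
  then show ?thesis by (simp add: vec_eq_iff matrix_vector_mult_basis column_def)
qed

lemma continuous_on_matrix_inv:
  "continuous_on {A :: real^'n^'n. det A \<noteq> 0} matrix_inv" (is "continuous_on ?D _")
proof -
  have "continuous_on ?D (\<lambda>A. det (\<chi> i l. if l = k then axis j 1 $ i else A $ i $ l))" for j k
  proof (rule continuous_on_compose2[OF continuous_on_det[of UNIV]])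
    have "continuous_on ?D (\<lambda>A. if l = k then axis j 1 $ i else A $ i $ l)" for i l
      by (cases "l = k") (auto intro!: continuous_intros)
    then show "continuous_on ?D (\<lambda>A. \<chi> i l. if l = k then axis j 1 $ i else A $ i $ l)"
      by (intro continuous_on_vec_lambda)
  qed simp
  then have "continuous_on ?D
      (\<lambda>A. \<chi> k j. det (\<chi> i l. if l = k then axis j 1 $ i else A $ i $ l) / det A)"
    by (intro continuous_on_vec_lambda continuous_on_divide continuous_on_det) auto
  then show ?thesis by (rule continuous_on_eq) (simp add: matrix_inv_cramer)
qed

lemma image_linear_add_eq_vimage_Pair_0:
  fixes f :: "'a::real_vector \<Rightarrow> 'b::real_vector"
  assumes f: "linear f"
  shows "(\<lambda>(x, y). f x + y) ` Y = Pair 0 -` (Y + {(x, y). f x + y = 0})"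
proof (intro equalityI subsetI)
  fix q assume "q \<in> (\<lambda>(x, y). f x + y) ` Y"
  then obtain x y where xy: "(x, y) \<in> Y" "q = f x + y" by auto
  have "(x, y) + (- x, f x) \<in> Y + {(x, y). f x + y = 0}"
    using xy(1) linear_neg[OF f] by (intro set_plus_intro) auto
  then show "q \<in> Pair 0 -` (Y + {(x, y). f x + y = 0})" by (simp add: xy(2) add.commute)
next
  fix q assume "q \<in> Pair 0 -` (Y + {(x, y). f x + y = 0})"
  then obtain x y u v where xy: "(x, y) \<in> Y" and "(0, q) = (x, y) + (u, v)" and uv: "f u + v = 0"
    by (auto elim!: set_plus_elim)
  then have "u = - x" "q = y + v" by (auto simp: add_eq_0_iff)
  moreover from this have "v = f x" using uv linear_neg[OF f, of x] by (simp add: add_eq_0_iff)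
  ultimately show "q \<in> (\<lambda>(x, y). f x + y) ` Y" using xy by (force simp: add.commute)
qed

definition fst_matrix :: "((real^'n) \<times> (real^'m))^'k \<Rightarrow> real^'k^'n" where
  "fst_matrix v = transpose (\<chi> j. fst (v $ j))"

definition snd_matrix :: "((real^'n) \<times> (real^'m))^'k \<Rightarrow> real^'k^'m" where
  "snd_matrix v = transpose (\<chi> j. snd (v $ j))"

definition kernel_matrix :: "((real^'n) \<times> (real^'m))^'n \<Rightarrow> real^'n^'m" where
  "kernel_matrix v = - (snd_matrix v ** matrix_inv (fst_matrix v))"

lemma span_range_eq_range_fst_snd_matrix:
  fixes v :: "((real^'n) \<times> (real^'m))^'k"
  shows "span (range (($) v)) = range (\<lambda>c. (fst_matrix v *v c, snd_matrix v *v c))"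
    (is "_ = range ?L")
proof -
  have "linear ?L"
    unfolding linear_iff by (simp add: matrix_vector_right_distrib matrix_vector_mult_scaleR)
  have "?L (axis j 1) = v $ j" for j
    by (simp add: fst_matrix_def snd_matrix_def matrix_vector_mult_basis column_transpose row_def
        prod_eq_iff del: transpose_matrix_vector)
  then have "range (($) v) = ?L ` Basis"
    by (force simp: Basis_vec_def image_iff)
  then show ?thesis using \<open>linear ?L\<close> by (simp add: linear_span_image)
qed

lemma span_range_eq_kernel:
  assumes "det (fst_matrix v) \<noteq> 0"
  shows "span (range (($) v)) = {(x, y). kernel_matrix v *v x + y = 0}"
proof -
  let ?inv = "matrix_inv (fst_matrix v)"
  have inv: "fst_matrix v ** ?inv = mat 1" "?inv ** fst_matrix v = mat 1"
    using assms by (auto intro!: matrix_inv_inverse simp: invertible_det_nz)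
  have kernel: "kernel_matrix v *v x = - (snd_matrix v *v (?inv *v x))" for x
    using matrix_vector_mult_diff_rdistrib[of 0 "snd_matrix v ** ?inv" x]
    by (simp add: kernel_matrix_def matrix_vector_mul_assoc)
  have "(x, y) \<in> range (\<lambda>c. (fst_matrix v *v c, snd_matrix v *v c)) \<longleftrightarrow>
      y = snd_matrix v *v (?inv *v x)" for x y
  proof
    assume "y = snd_matrix v *v (?inv *v x)"
    moreover have "x = fst_matrix v *v (?inv *v x)" by (simp add: matrix_vector_mul_assoc inv)
    ultimately show "(x, y) \<in> range (\<lambda>c. (fst_matrix v *v c, snd_matrix v *v c))" by blast
  qed (auto simp: matrix_vector_mul_assoc inv matrix_mul_assoc[symmetric])
  then show ?thesis
    unfolding span_range_eq_range_fst_snd_matrix by (auto simp: kernel)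
qed

lemma kernel_matrix_neighbourhood:
  fixes S :: "(real^'n^'m) set"
  assumes S: "open S" "F \<in> S"
  obtains A :: "'n \<Rightarrow> ((real^'n) \<times> (real^'m)) set"
  where "\<And>j. open (A j)" "\<And>j. A j \<noteq> {}"
    "\<And>v. (\<And>j. v $ j \<in> A j) \<Longrightarrow> det (fst_matrix v) \<noteq> 0 \<and> kernel_matrix v \<in> S"
proof -
  have cont: "continuous_on B (fst_matrix :: ((real^'n) \<times> (real^'m))^'n \<Rightarrow> _)"
      "continuous_on B (snd_matrix :: ((real^'n) \<times> (real^'m))^'n \<Rightarrow> _)" for B
    unfolding fst_matrix_def[abs_def] snd_matrix_def[abs_def] transpose_def
    by (auto intro!: continuous_intros)
  let ?D = "{v :: ((real^'n) \<times> (real^'m))^'n. det (fst_matrix v) \<noteq> 0}"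
  have "continuous_on ?D kernel_matrix"
    unfolding kernel_matrix_def[abs_def]
    by (intro continuous_on_minus continuous_on_matrix_matrix_mult cont
        continuous_on_compose2[OF continuous_on_matrix_inv]) auto
  moreover have "open ?D"
    by (intro open_Collect_neq continuous_on_compose2[OF continuous_on_det cont(1)]) auto
  ultimately have "open (?D \<inter> kernel_matrix -` S)" using S(1) by (rule continuous_open_preimage)
  define v0 :: "((real^'n) \<times> (real^'m))^'n" where "v0 = (\<chi> j. (axis j 1, - column j F))"
  have "fst_matrix v0 = mat 1" "snd_matrix v0 = - F"
    by (auto simp: fst_matrix_def snd_matrix_def v0_def vec_eq_iff transpose_def mat_def axis_def
        column_def)
  moreover have "matrix_inv (mat 1 :: real^'n^'n) = mat 1"
    using matrix_inv_inverse(1)[of "mat 1 :: real^'n^'n"] by (auto simp: invertible_def)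
  ultimately have "v0 \<in> ?D \<inter> kernel_matrix -` S" using S(2) by (simp add: kernel_matrix_def)
  then obtain A where "\<And>j. open (A j)" "\<And>j. v0 $ j \<in> A j"
      "\<And>v. (\<And>j. v $ j \<in> A j) \<Longrightarrow> v \<in> ?D \<inter> kernel_matrix -` S"
    using \<open>open (?D \<inter> kernel_matrix -` S)\<close> unfolding open_vec_def by metis
  then show ?thesis by (intro that[of A]) auto
qed

lemma closed_linear_image_dense:
  fixes Y :: "((real^'n) \<times> (real^'m)) set"
  assumes Y: "closed Y" "semialgebraic Y" and S: "open S" "S \<noteq> {}"
  shows "\<exists>F\<in>S. closed ((\<lambda>(x, y). F *v x + y) ` Y)"
proof -
  obtain F where "F \<in> S" using S(2) by blast
  obtain A :: "'n \<Rightarrow> ((real^'n) \<times> (real^'m)) set" where A: "\<And>j. open (A j)" "\<And>j. A j \<noteq> {}"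
      "\<And>v. (\<And>j. v $ j \<in> A j) \<Longrightarrow> det (fst_matrix v) \<noteq> 0 \<and> kernel_matrix v \<in> S"
    using kernel_matrix_neighbourhood[OF S(1) \<open>F \<in> S\<close>] by metis
  obtain w where w: "\<And>j. w j \<in> A j" "closed (Y + span (range w))"
    using closed_add_span_generic[OF Y finite_class.finite_UNIV, of A] A(1,2) by blast
  define v where "v = vec_lambda w"
  have v: "det (fst_matrix v) \<noteq> 0" "kernel_matrix v \<in> S" using A(3)[of v] w(1) by (auto simp: v_def)
  have "range w = range (($) v)" by (simp add: v_def)
  then have "closed (Y + {(x, y). kernel_matrix v *v x + y = 0})"
    using w(2) span_range_eq_kernel[OF v(1)] by simp
  then have "closed (Pair 0 -` (Y + {(x, y). kernel_matrix v *v x + y = 0}))"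
    by (intro closed_vimage continuous_intros)
  then have "closed ((\<lambda>(x, y). kernel_matrix v *v x + y) ` Y)"
    unfolding image_linear_add_eq_vimage_Pair_0[OF matrix_vector_mul_linear] .
  then show ?thesis using v(2) by blast
qed

lemma semialgebraic_closed_linear_image:
  fixes Y :: "((real^'n) \<times> (real^'m)) set"
  assumes "semialgebraic Y"
  shows "semialgebraic {F. closed ((\<lambda>(x, y). F *v x + y) ` Y)}"
proof -
  let ?F = "\<lambda>p :: ((real^'n^'m) \<times> (real^'m)) \<times> ((real^'n) \<times> (real^'m)). fst (fst p)"
    and ?q = "\<lambda>p :: ((real^'n^'m) \<times> (real^'m)) \<times> ((real^'n) \<times> (real^'m)). snd (fst p)"
  have "(\<lambda>p. (\<Sum>j\<in>UNIV. ?F p $ i $ j * fst (snd p) $ j) + snd (snd p) $ i) \<in> poly_fun" for i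
    by (intro poly_fun.add poly_fun_sum poly_fun.mult poly_fun_linear) (auto simp: linear_iff)
  then have "poly_map (\<lambda>p. ?F p *v fst (snd p) + snd (snd p))"
    by (auto simp: poly_map_def Basis_vec_def inner_axis matrix_vector_mult_def)
  then have "semialgebraic {p. ?q p = ?F p *v fst (snd p) + snd (snd p)}"
    by (intro semialgebraic_Collect_eq poly_map_linear[of ?q]) (auto simp: linear_iff)
  moreover have "semialgebraic {p. snd p \<in> Y}"
    using assms by (intro semialgebraic_vimage poly_map_linear linear_snd)
  ultimately have "semialgebraic {((F, q), z). z \<in> Y \<and> q = F *v fst z + snd z}"
    using semialgebraic_Collect_conj by (fastforce simp: case_prod_unfold)
  then have "semialgebraic {(F, q). \<exists>z. z \<in> Y \<and> q = F *v fst z + snd z}"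
    using semialgebraic_Collect_ex[of "\<lambda>(F, q) z. z \<in> Y \<and> q = F *v fst z + snd z"]
    by (simp add: case_prod_unfold)
  from semialgebraic_fibrewise_closed[OF this]
  show ?thesis by (simp add: image_def case_prod_unfold Bex_def)
qed

lemma dense_semialgebraic_contains_open_dense:
  assumes S: "semialgebraic S" "closure S = UNIV"
  shows "\<exists>U. semialgebraic U \<and> open U \<and> closure U = UNIV \<and> U \<subseteq> S"
proof -
  obtain f a where f: "f \<in> poly_fun" "f a \<noteq> 0" "frontier S \<subseteq> {x. f x = 0}"
    using frontier_semialgebraic_subset_zeros[OF S(1)] by blast
  let ?U = "{x. f x \<noteq> 0}"
  have "semialgebraic ?U" by (intro semialgebraic_Collect_not semialgebraic_Collect_eq_0 f(1))
  moreover have "open ?U"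
    by (intro open_Collect_neq continuous_on_poly_fun f(1) poly_fun.const)
  moreover have "x \<in> closure ?U" for x
    unfolding closure_iff_nhds_not_empty using poly_fun_nonzero_dense[OF f(1,2)] by blast
  moreover have "?U \<subseteq> S"
    using f(3) S(2) interior_subset by (auto simp: frontier_def)
  ultimately show ?thesis by blast
qed

theorem mainTheorem1:
  fixes X :: "(real^'n) set" and G :: "real^'n \<Rightarrow> real^'m"
  assumes "closed X" and "semialgebraic X"
    and "continuous_on X G" and "semialgebraic_map X G"
  shows "semialgebraic {F :: real^'n^'m. closed ((\<lambda>x. F *v x + G x) ` X)} \<and>
         (\<exists>U :: (real^'n^'m) set. semialgebraic U \<and> open U \<and> closure U = UNIV \<and>
            U \<subseteq> {F. closed ((\<lambda>x. F *v x + G x) ` X)})"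
proof -
  define Y where "Y = {(x, G x) | x. x \<in> X}"
  have "Y = (\<lambda>x. (x, G x)) ` X" by (auto simp: Y_def)
  then have Y: "closed Y" "semialgebraic Y"
    using assms by (simp_all add: continuous_closed_graph semialgebraic_map_def flip: Y_def)
  have image: "(\<lambda>x. F *v x + G x) ` X = (\<lambda>(x, y). F *v x + y) ` Y" for F
    by (force simp: Y_def)
  let ?S = "{F :: real^'n^'m. closed ((\<lambda>x. F *v x + G x) ` X)}"
  have "semialgebraic ?S"
    unfolding image using Y(2) by (rule semialgebraic_closed_linear_image)
  moreover have "F \<in> closure ?S" for F
    unfolding image closure_iff_nhds_not_empty using closed_linear_image_dense[OF Y] by blast
  then have "closure ?S = UNIV" by blast
  ultimately show ?thesis using dense_semialgebraic_contains_open_dense by blast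
qed

end
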